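(* Let $A=\{A_0,A_1\}$ with $A_0\cap A_1=\emptyset$ and $A_0\cup A_1=\mathbb Z$. Assume that $(u^0,u^1)\setminus I_0\neq\emptyset$ and $(u^0,u^1)\setminus I_1\neq\emptyset$, and that there is no $i\in\mathbb Z$ such that $i-1\in A_{|j-1|}$, $i\in A_j$ and $i+1\in A_{|j-1|}$ for $j=0$ or $j=1$. Then for every $\epsilon>0$ there exist $k\in K$ and $\rho\in\tilde P$ with $\rho_i<\epsilon$ for all $i\in\mathbb Z$ such that $x^\ast(k,\rho,A)$ is a stationary configuration and it has $\#\mathcal S$ transitions.
   Context: Standing assumptions: $h:\mathbb R^2\to\mathbb R$ is Lipschitz continuous and satisfies: (h1) $h(\xi,\eta)=h(\xi+1,\eta+1)$ for all $\xi,\eta$; (h2) $h(\xi,\xi+\eta)\to\infty$ as $|\eta|\to\infty$, uniformly in $\xi$; (h3) if $\underline\xi<\bar\xi$ and $\underline\eta<\bar\eta$ then $h(\underline\xi,\underline\eta)+h(\bar\xi,\bar\eta)<h(\underline\xi,\bar\eta)+h(\bar\xi,\underline\eta)$; (h4) if $(x,x_0,x_1)$ and $(\xi,x_0,\xi_1)$ are minimal and distinct then $(x-\xi)(x_1-\xi_1)<0$; (h5) there is a positive continuous function $p$ on $\mathbb R^2$ with $h(\xi,\eta')+h(\eta,\xi')-h(\xi,\xi')-h(\eta,\eta')>\int_\xi^\eta\int_{\xi'}^{\eta'}p$ whenever $\xi<\eta$ and $\xi'<\eta'$; (h6) there is $\theta>0$ such that $\xi\mapsto\theta\xi^2/2-h(\xi,\xi')$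 is convex for every $\xi'$ and $\xi'\mapsto\theta\xi'^2/2-h(\xi,\xi')$ is convex for every $\xi$. Here $h(x_m,\dots,x_n)=\sum_{i=m}^{n-1}h(x_i,x_{i+1})$. A finite sequence is minimal if for each of its segments $(x_{n_0},\dots,x_{n_1})$ and each $(y_{n_0},\dots,y_{n_1})$ with the same end points, $h(x_{n_0},\dots,x_{n_1})\le h(y_{n_0},\dots,y_{n_1})$; a bi-infinite sequence (configuration) is minimal if all its finite segments are. A configuration $x\in\mathbb R^{\mathbb Z}$ is stationary if $\partial_2h(x_{i-1},x_i)+\partial_1h(x_i,x_{i+1})=0$ for all $i\in\mathbb Z$ (partial derivatives being understood, where needed, as left-sided derivatives). It has rotation number $\alpha$ if $\lim_{i\to\infty}x_i/i=\lim_{i\to-\infty}x_i/i=\alpha$. $(u^0,u^1)$, $u^0<u^1$, is a fixed neighboring pair: the constant configurations $u^0$ and $u^1$ are minimal and no constant configuration $u$ with $u^0<u<u^1$ is minimal. $c=\min_{x\in\mathbb R}h(x,x)=h(u^0,u^0)=h(u^1,u^1)$. $I_0$ is the set of $x_0\in\mathbb R$ for which there is a minimal configuration $x=(x_i)$ with rotation number $0$, $x_i\to u^0$ as $i\to-\infty$ and $x_i\to u^1$ as $i\to\infty$; $I_1$ is the set of $x_0$ for which there is a minimal configuration $x$ with rotation number $0$, $x_i\to u^1$ as $i\to-\infty$ and $x_i\to u^0$ as $i\to\infty$. $X=\{x\in\mathbb R^{\mathbb Z}: u^0\le x_i\le u^1\ \forall i\}$, $Y^j(l,r)=\{x\in X:|x_l-u^j|\le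 r\}$ ($j=0,1$). $K=\{(k_i)_{i\in\mathbb Z}\subset\mathbb Z: k_0=0,\ k_i<k_{i+1}\ \forall i\}$. $\mathcal S=\mathcal S(A)=\{i\in\mathbb Z: i\in A_j\text{ and }i+1\in A_{|j-1|}\text{ for }j=0\text{ or }1\}$, and $\#\mathcal S$ is its cardinality (possibly infinite). $\tilde P=\{(\rho_i)_{i\in\mathbb Z}:0<\rho_i<(u^1-u^0)/2,\ \sum_{i\in\mathcal S}\rho_i<\infty\}$. $X_{k,\rho}(A)=\bigcap_{i\in A_0}Y^0(k_i,\rho_i)\cap\bigcap_{i\in A_1}Y^1(k_i,\rho_i)$. Put $I_i=\{k_i,\dots,k_{i+1}-1\}$, $|I_i|=k_{i+1}-k_i$, $c_i^+=\min\{\sum_{j\in I_i}h(x_j,x_{j+1}): x\in Y^0(k_i,\rho_i)\cap Y^1(k_{i+1},\rho_{i+1})\}$, $c_i^-=\min\{\sum_{j\in I_i}h(x_j,x_{j+1}): x\in Y^1(k_i,\rho_i)\cap Y^0(k_{i+1},\rho_{i+1})\}$. $B_i(x)=\sum_{j\in I_i}h(x_j,x_{j+1})-|I_i|c$ if $i,i+1\in A_0$ or $i,i+1\in A_1$; $B_i(x)=\sum_{j\in I_i}h(x_j,x_{j+1})-c_i^+$ if $i\in A_0$, $i+1\in A_1$; $B_i(x)=\sum_{j\in I_i}h(x_j,x_{j+1})-c_i^-$ if $i\in A_1$, $i+1\in A_0$. $\tilde J(x)=\tilde J_{k,\rho,A}(x)=\sum_{i\in\mathbb Z}B_i(x)=\lim_{n\to\infty}\sum_{|i|\le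 n}B_i(x)$ for $x\in X_{k,\rho}(A)$. $x^\ast(k,\rho,A)$ denotes a minimizer of $\tilde J$ on $X_{k,\rho}(A)$: $\tilde J(x^\ast(k,\rho,A))=\inf_{x\in X_{k,\rho}(A)}\tilde J(x)$. A configuration has $n$ transitions if it passes alternately through neighborhoods of $u^0$ and $u^1$, $n$ being the number of times it changes from a neighborhood of one of them to a neighborhood of the other (changes in both directions are counted); for an element of $X_{k,\rho}(A)$ the neighborhoods are those of radius $\rho_i$ visited at the times $k_i$, i.e. around $u^0$ for $i\in A_0$ and around $u^1$ for $i\in A_1$. *)

theory Defs
  imports "HOL-Analysis.Analysis" "HOL-Library.Extended_Nat"
begin

text \<open>
  Configurations are functions \<open>int \<Rightarrow> real\<close>. A finite sequence \<open>(x\<^sub>m, \<dots>, x\<^sub>n)\<close> is represented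
  by any function \<open>int \<Rightarrow> real\<close> together with the bounds \<open>m\<close> and \<open>n\<close>; only its values on
  \<open>{m..n}\<close> matter.
\<close>

definition action :: "(real \<Rightarrow> real \<Rightarrow> real) \<Rightarrow> (int \<Rightarrow> real) \<Rightarrow> int \<Rightarrow> int \<Rightarrow> real" where
  "action h x m n = (\<Sum>i\<in>{m..<n}. h (x i) (x (i + 1)))"

definition minimal_on :: "(real \<Rightarrow> real \<Rightarrow> real) \<Rightarrow> int \<Rightarrow> int \<Rightarrow> (int \<Rightarrow> real) \<Rightarrow> bool" where
  "minimal_on h m n x \<longleftrightarrow>
     (\<forall>n0 n1 y. m \<le> n0 \<and> n0 \<le> n1 \<and> n1 \<le> n \<and> y n0 = x n0 \<and> y n1 = x n1
        \<longrightarrow> action h x n0 n1 \<le> action h y n0 n1)"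

definition minimal :: "(real \<Rightarrow> real \<Rightarrow> real) \<Rightarrow> (int \<Rightarrow> real) \<Rightarrow> bool" where
  "minimal h x \<longleftrightarrow> (\<forall>m n. m \<le> n \<longrightarrow> minimal_on h m n x)"

text \<open>
  In \<open>h4\<close> the minimal triples \<open>(x, x\<^sub>0, x\<^sub>1)\<close> and \<open>(\<xi>, x\<^sub>0, \<xi>\<^sub>1)\<close> are the restrictions of
  \<open>x\<close> and \<open>y\<close> to \<open>{-1..1}\<close>.
\<close>

locale twist_potential =
  fixes h :: "real \<Rightarrow> real \<Rightarrow> real"
  assumes lipschitz: "\<exists>L. L-lipschitz_on UNIV (\<lambda>(\<xi>, \<eta>). h \<xi> \<eta>)"
    and h1: "\<And>\<xi> \<eta>. h \<xi> \<eta> = h (\<xi> + 1) (\<eta> + 1)"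
    and h2: "\<And>M. \<exists>R. \<forall>\<xi> \<eta>. \<bar>\<eta>\<bar> \<ge> R \<longrightarrow> h \<xi> (\<xi> + \<eta>) \<ge> M"
    and h3: "\<And>\<xi> \<xi>' \<eta> \<eta>'. \<xi> < \<xi>' \<Longrightarrow> \<eta> < \<eta>' \<Longrightarrow> h \<xi> \<eta> + h \<xi>' \<eta>' < h \<xi> \<eta>' + h \<xi>' \<eta>"
    and h4: "\<And>x y :: int \<Rightarrow> real.
      minimal_on h (-1) 1 x \<Longrightarrow> minimal_on h (-1) 1 y \<Longrightarrow> x 0 = y 0 \<Longrightarrow>
      (x (-1), x 1) \<noteq> (y (-1), y 1) \<Longrightarrow> (x (-1) - y (-1)) * (x 1 - y 1) < 0"
    and h5: "\<exists>p :: real \<times> real \<Rightarrow> real. continuous_on UNIV p \<and> (\<forall>z. 0 < p z) \<and>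
      (\<forall>\<xi> \<eta> \<xi>' \<eta>'. \<xi> < \<eta> \<and> \<xi>' < \<eta>' \<longrightarrow>
        h \<xi> \<eta>' + h \<eta> \<xi>' - h \<xi> \<xi>' - h \<eta> \<eta>' >
          integral {\<xi>..\<eta>} (\<lambda>s. integral {\<xi>'..\<eta>'} (\<lambda>t. p (s, t))))"
    and h6: "\<exists>\<theta>>0. (\<forall>\<xi>'. convex_on UNIV (\<lambda>\<xi>. \<theta> * \<xi>\<^sup>2 / 2 - h \<xi> \<xi>')) \<and>
      (\<forall>\<xi>. convex_on UNIV (\<lambda>\<xi>'. \<theta> * \<xi>'\<^sup>2 / 2 - h \<xi> \<xi>'))"

text \<open>
  Under \<open>h6\<close> all one-sided partial derivatives exist, and the left-sided one is the ordinary
  derivative wherever the latter exists.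
\<close>

definition stationary :: "(real \<Rightarrow> real \<Rightarrow> real) \<Rightarrow> (int \<Rightarrow> real) \<Rightarrow> bool" where
  "stationary h x \<longleftrightarrow>
     (\<forall>i. \<exists>d2 d1.
        ((\<lambda>t. h (x (i - 1)) t) has_real_derivative d2) (at_left (x i)) \<and>
        ((\<lambda>t. h t (x (i + 1))) has_real_derivative d1) (at_left (x i)) \<and>
        d2 + d1 = 0)"

definition has_rotation_number :: "(int \<Rightarrow> real) \<Rightarrow> real \<Rightarrow> bool" where
  "has_rotation_number x \<alpha> \<longleftrightarrow>
     ((\<lambda>i. x i / of_int i) \<longlongrightarrow> \<alpha>) at_top \<and> ((\<lambda>i. x i / of_int i) \<longlongrightarrow> \<alpha>) at_bot"

definition neighboring_pair :: "(real \<Rightarrow> real \<Rightarrow> real) \<Rightarrow> real \<Rightarrow> real \<Rightarrow> bool" where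
  "neighboring_pair h u0 u1 \<longleftrightarrow>
     u0 < u1 \<and> minimal h (\<lambda>_. u0) \<and> minimal h (\<lambda>_. u1) \<and>
     (\<forall>u. u0 < u \<and> u < u1 \<longrightarrow> \<not> minimal h (\<lambda>_. u))"

text \<open>The constant \<open>c\<close>; the infimum is attained, by continuity and \<open>h1\<close>.\<close>

definition min_level :: "(real \<Rightarrow> real \<Rightarrow> real) \<Rightarrow> real" where
  "min_level h = (INF x. h x x)"

text \<open>\<open>I\<^sub>0\<close> is \<open>heteroclinic_values h u0 u1\<close> and \<open>I\<^sub>1\<close> is \<open>heteroclinic_values h u1 u0\<close>.\<close>

definition heteroclinic_values ::
    "(real \<Rightarrow> real \<Rightarrow> real) \<Rightarrow> real \<Rightarrow> real \<Rightarrow> real set" where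
  "heteroclinic_values h a b =
     {x 0 | x :: int \<Rightarrow> real. minimal h x \<and> has_rotation_number x 0 \<and>
        (x \<longlongrightarrow> a) at_bot \<and> (x \<longlongrightarrow> b) at_top}"

definition X_space :: "real \<Rightarrow> real \<Rightarrow> (int \<Rightarrow> real) set" where
  "X_space u0 u1 = {x. \<forall>i. u0 \<le> x i \<and> x i \<le> u1}"

text \<open>\<open>Y\<^sup>j(l, r)\<close> is \<open>Y_space u0 u1 v l r\<close> with \<open>v = u\<^sup>j\<close>.\<close>

definition Y_space :: "real \<Rightarrow> real \<Rightarrow> real \<Rightarrow> int \<Rightarrow> real \<Rightarrow> (int \<Rightarrow> real) set" where
  "Y_space u0 u1 v l r = {x \<in> X_space u0 u1. \<bar>x l - v\<bar> \<le> r}"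

definition K_seqs :: "(int \<Rightarrow> int) set" where
  "K_seqs = {k. k 0 = 0 \<and> (\<forall>i. k i < k (i + 1))}"

definition switches :: "int set \<Rightarrow> int set \<Rightarrow> int set" where
  "switches A0 A1 = {i. (i \<in> A0 \<and> i + 1 \<in> A1) \<or> (i \<in> A1 \<and> i + 1 \<in> A0)}"

definition P_seqs :: "real \<Rightarrow> real \<Rightarrow> int set \<Rightarrow> int set \<Rightarrow> (int \<Rightarrow> real) set" where
  "P_seqs u0 u1 A0 A1 =
     {\<rho>. (\<forall>i. 0 < \<rho> i \<and> \<rho> i < (u1 - u0) / 2) \<and> \<rho> summable_on (switches A0 A1)}"

definition X_constr ::
    "real \<Rightarrow> real \<Rightarrow> int set \<Rightarrow> int set \<Rightarrow> (int \<Rightarrow> int) \<Rightarrow> (int \<Rightarrow> real) \<Rightarrow> (int \<Rightarrow> real) set" where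
  "X_constr u0 u1 A0 A1 k \<rho> =
     (\<Inter>i\<in>A0. Y_space u0 u1 u0 (k i) (\<rho> i)) \<inter> (\<Inter>i\<in>A1. Y_space u0 u1 u1 (k i) (\<rho> i))"

text \<open>
  \<open>c\<^sub>i\<^sup>+\<close> is \<open>switch_cost h u0 u1 u0 u1 k \<rho> i\<close> and \<open>c\<^sub>i\<^sup>-\<close> is \<open>switch_cost h u0 u1 u1 u0 k \<rho> i\<close>.
  The infimum is attained: only the coordinates \<open>k i, \<dots>, k (i + 1)\<close> enter, and they range over
  a compact box.
\<close>

definition switch_cost ::
    "(real \<Rightarrow> real \<Rightarrow> real) \<Rightarrow> real \<Rightarrow> real \<Rightarrow> real \<Rightarrow> real \<Rightarrow>
     (int \<Rightarrow> int) \<Rightarrow> (int \<Rightarrow> real) \<Rightarrow> int \<Rightarrow> real" where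
  "switch_cost h u0 u1 a b k \<rho> i =
     (INF x \<in> Y_space u0 u1 a (k i) (\<rho> i) \<inter> Y_space u0 u1 b (k (i + 1)) (\<rho> (i + 1)).
        action h x (k i) (k (i + 1)))"

definition B_term ::
    "(real \<Rightarrow> real \<Rightarrow> real) \<Rightarrow> real \<Rightarrow> real \<Rightarrow> int set \<Rightarrow> int set \<Rightarrow>
     (int \<Rightarrow> int) \<Rightarrow> (int \<Rightarrow> real) \<Rightarrow> (int \<Rightarrow> real) \<Rightarrow> int \<Rightarrow> real" where
  "B_term h u0 u1 A0 A1 k \<rho> x i =
     action h x (k i) (k (i + 1)) -
       (if i \<in> A0 \<and> i + 1 \<in> A1 then switch_cost h u0 u1 u0 u1 k \<rho> i
        else if i \<in> A1 \<and> i + 1 \<in> A0 then switch_cost h u0 u1 u1 u0 k \<rho> i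
        else of_int (k (i + 1) - k i) * min_level h)"

definition J_partial ::
    "(real \<Rightarrow> real \<Rightarrow> real) \<Rightarrow> real \<Rightarrow> real \<Rightarrow> int set \<Rightarrow> int set \<Rightarrow>
     (int \<Rightarrow> int) \<Rightarrow> (int \<Rightarrow> real) \<Rightarrow> (int \<Rightarrow> real) \<Rightarrow> nat \<Rightarrow> ereal" where
  "J_partial h u0 u1 A0 A1 k \<rho> x n =
     ereal (\<Sum>i\<in>{i. \<bar>i\<bar> \<le> int n}. B_term h u0 u1 A0 A1 k \<rho> x i)"

definition J_functional ::
    "(real \<Rightarrow> real \<Rightarrow> real) \<Rightarrow> real \<Rightarrow> real \<Rightarrow> int set \<Rightarrow> int set \<Rightarrow>
     (int \<Rightarrow> int) \<Rightarrow> (int \<Rightarrow> real) \<Rightarrow> (int \<Rightarrow> real) \<Rightarrow> ereal" where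
  "J_functional h u0 u1 A0 A1 k \<rho> x = lim (J_partial h u0 u1 A0 A1 k \<rho> x)"

text \<open>
  The convergence clause says that the functional is well defined, with values in the extended
  reals, on the whole constraint set; without it, \<open>lim\<close> could be an unspecified value.
\<close>

definition J_minimizer ::
    "(real \<Rightarrow> real \<Rightarrow> real) \<Rightarrow> real \<Rightarrow> real \<Rightarrow> int set \<Rightarrow> int set \<Rightarrow>
     (int \<Rightarrow> int) \<Rightarrow> (int \<Rightarrow> real) \<Rightarrow> (int \<Rightarrow> real) \<Rightarrow> bool" where
  "J_minimizer h u0 u1 A0 A1 k \<rho> x \<longleftrightarrow>
     x \<in> X_constr u0 u1 A0 A1 k \<rho> \<and>
     (\<forall>y \<in> X_constr u0 u1 A0 A1 k \<rho>. convergent (J_partial h u0 u1 A0 A1 k \<rho> y)) \<and>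
     J_functional h u0 u1 A0 A1 k \<rho> x =
       (INF y \<in> X_constr u0 u1 A0 A1 k \<rho>. J_functional h u0 u1 A0 A1 k \<rho> y)"

definition ecard :: "'a set \<Rightarrow> enat" where
  "ecard S = (if finite S then enat (card S) else \<infinity>)"

text \<open>
  Transitions are read off from the configuration itself: at every time \<open>k i\<close> it lies in the
  \<open>\<rho> i\<close>-neighborhood of \<open>u0\<close> or of \<open>u1\<close> (these are disjoint if \<open>\<rho> i < (u1 - u0) / 2\<close>), and
  one counts the \<open>i\<close> for which the neighborhoods visited at \<open>k i\<close> and \<open>k (i + 1)\<close> belong to
  different points.
\<close>

definition visits :: "(int \<Rightarrow> int) \<Rightarrow> (int \<Rightarrow> real) \<Rightarrow> (int \<Rightarrow> real) \<Rightarrow> real \<Rightarrow> int \<Rightarrow> bool" where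
  "visits k \<rho> x v i \<longleftrightarrow> \<bar>x (k i) - v\<bar> \<le> \<rho> i"

definition has_transitions ::
    "real \<Rightarrow> real \<Rightarrow> (int \<Rightarrow> int) \<Rightarrow> (int \<Rightarrow> real) \<Rightarrow> (int \<Rightarrow> real) \<Rightarrow> enat \<Rightarrow> bool" where
  "has_transitions u0 u1 k \<rho> x n \<longleftrightarrow>
     (\<forall>i. visits k \<rho> x u0 i \<or> visits k \<rho> x u1 i) \<and>
     ecard {i. (visits k \<rho> x u0 i \<and> visits k \<rho> x u1 (i + 1)) \<or>
               (visits k \<rho> x u1 i \<and> visits k \<rho> x u0 (i + 1))} = n"

end

theory Submission
  imports Defs
begin

text \<open>
  Write \<open>e a b = h a b - c\<close> for the excess of a step over the rest level, so that \<open>e\<close> vanishes at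
  \<open>(u0, u0)\<close> and \<open>(u1, u1)\<close>. Because a submodular function prefers the increasing matching, the
  excess of a closed chain is at least the sum of the diagonal excesses \<open>e a a\<close> of the points that it
  visits (\<open>cyclic_sum_ge_diagonal\<close>). The diagonal excess is nonnegative, and it is positive strictly
  between the two rest points. So every chain inside \<open>[u0, u1]\<close> has excess bounded below by
  minus a multiple of the distance of its end points, and every visit away from the rest points costs a
  definite amount.

  Let \<open>D a b\<close> be the infimum of the excess over all chains from \<open>a\<close> to \<open>b\<close> inside \<open>[u0, u1]\<close>, and
  call \<open>D p y + D y q - D p q\<close> the defect of \<open>y\<close> for the passage from \<open>p\<close> to \<open>q\<close>: what it costs to
  be forced through \<open>y\<close>. If the defect of \<open>y\<close> is zero for two different rest points \<open>p\<close> and \<open>q\<close>,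
  then optimal predecessors and successors of \<open>y\<close> form a minimal configuration
  from \<open>p\<close> to \<open>q\<close> through \<open>y\<close> (\<open>tight_heteroclinic\<close>); hence a gap in the heteroclinic values is a
  point of positive defect. Such points then exist arbitrarily close to both rest points
  (\<open>defect_pos_near_source\<close>, \<open>defect_pos_near_target\<close>): optimal predecessors are unique and
  depend continuously on the point, so the component of the zero set of the defect that contains \<open>q\<close>
  is mapped into itself by taking predecessors; but iterated predecessors converge to \<open>p\<close>, so this
  component is \<open>{q}\<close> or everything.

  The radii \<open>\<rho> i\<close> are now chosen summable and such that the boundary point of the \<open>i\<close>-th constraint
  has positive defect for the passage from the rest point prescribed at \<open>i - 1\<close> to the one prescribed
  at \<open>i + 1\<close>; after that the gaps of \<open>k\<close> are chosen large (\<open>rigid_itinerary_exists\<close>). Summability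
  makes the renormalized functional a series of almost nonnegative continuous terms, so it converges
  on the compact constraint set and has a minimizer of finite value (\<open>almost_nonneg_series_minimizer\<close>).
  A minimizer costs no more than any admissible competitor that differs from it in finitely many places. In every
  long block whose two prescribed rest points agree it comes extremely close to that rest point, since
  staying away costs too much. As no symbol is isolated, each time \<open>k i\<close> lies between two
  such moments of rest, one at the rest point prescribed at \<open>i - 1\<close> and one at the rest point
  prescribed at \<open>i + 1\<close>. If the \<open>i\<close>-th constraint were active, the configuration would pay, up to
  a small tolerance, the defect more than a near-optimal passage between the same two moments, which is
  admissible as well: a contradiction (\<open>constraint_strict\<close>).

  So all constraints \<open>\<bar>x (k i) - v i\<bar> \<le> \<rho> i\<close> are strict, and the barriers \<open>u0\<close>, \<open>u1\<close> do no harm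
  because clamping to \<open>[u0, u1]\<close> never increases the action. Every single coordinate thus sits at a
  local minimum of a semiconcave function, where the left derivative vanishes.
\<close>

section \<open>Action of finite segments and the rearrangement inequality\<close>

lemma action_split:
  assumes "m \<le> n" "n \<le> q"
  shows "action e x m q = action e x m n + action e x n q"
proof -
  have "{m..<q} = {m..<n} \<union> {n..<q}" using assms by auto
  then show ?thesis unfolding action_def by (simp add: sum.union_disjoint)
qed

lemma action_refl [simp]: "action e x m m = 0"
  by (simp add: action_def)

lemma action_step [simp]: "action e x n (n + 1) = e (x n) (x (n + 1))"
proof -
  have "{n..<n+1} = {n}" by auto
  then show ?thesis by (simp add: action_def)
qed

lemma action_first:
  "m < n \<Longrightarrow> action e x m n = e (x m) (x (m + 1)) + action e x (m + 1) n"
  using action_split[of m "m+1" n e x] by simp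

lemma action_last:
  "m < n \<Longrightarrow> action e x m n = action e x m (n - 1) + e (x (n - 1)) (x n)"
  using action_split[of m "n-1" n e x] action_step[of e x "n-1"] by simp

lemma action_cong:
  "(\<And>i. m \<le> i \<Longrightarrow> i \<le> n \<Longrightarrow> x i = y i) \<Longrightarrow> action e x m n = action e y m n"
  unfolding action_def by (intro sum.cong) auto

lemma action_shift: "action e (\<lambda>i. x (i + s)) m n = action e x (m + s) (n + s)"
  unfolding action_def
  by (rule sum.reindex_bij_witness[where i = "\<lambda>i. i - s" and j = "\<lambda>i. i + s"])
     (auto simp: algebra_simps)

lemma action_reverse:
  "action (\<lambda>a b. e b a) (\<lambda>i. x (- i)) (- n) (- m) = action e x m n"
  unfolding action_def
  by (rule sum.reindex_bij_witness[where i = "\<lambda>i. - i - 1" and j = "\<lambda>i. - i - 1"])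
     (auto simp: algebra_simps)

lemma action_const: "m \<le> n \<Longrightarrow> action e (\<lambda>_. u) m n = of_int (n - m) * e u u"
  by (simp add: action_def)

lemma action_minus_const:
  "m \<le> n \<Longrightarrow> action (\<lambda>a b. h a b - c) x m n = action h x m n - of_int (n - m) * c"
  by (simp add: action_def sum_subtractf)

text \<open>
  The closed chain is a matching of its points with themselves, and under submodularity the
  increasing matching, here the identity, is the cheapest. The induction cuts the closed chain
  into two shorter closed chains by exchanging the targets of two of its steps: the closing step
  from \<open>x n\<close> back to \<open>x m\<close> and a step from \<open>x (q - 1)\<close> to \<open>x q\<close>. The exchange does not increase the
  cost if the two sources are ordered like the two targets after the exchange.
\<close>

lemma cyclic_sum_ge_diagonal:
  fixes e :: "real \<Rightarrow> real \<Rightarrow> real"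
  assumes submod: "\<And>a a' b b'. a \<le> a' \<Longrightarrow> b \<le> b' \<Longrightarrow> e a b + e a' b' \<le> e a b' + e a' b"
    and "m \<le> n"
  shows "(\<Sum>i\<in>{m..n}. e (x i) (x i)) \<le> action e x m n + e (x n) (x m)"
  using \<open>m \<le> n\<close>
proof (induction "nat (n - m)" arbitrary: m n rule: less_induct)
  case less
  show ?case
  proof (cases "m = n")
    case True
    then show ?thesis by simp
  next
    case False
    with less.prems have mn: "m < n" by simp
    \<comment> \<open>Such a step is the first one that returns to the side of \<open>x m\<close> on which \<open>x n\<close> lies.\<close>
    have "\<exists>q. m < q \<and> q \<le> n \<and>
      ((x (q-1) \<le> x n \<and> x m \<le> x q) \<or> (x n \<le> x (q-1) \<and> x q \<le> x m))"
    proof -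
      have ex: "\<exists>q. m < q \<and> q \<le> n \<and> R q \<and> (\<forall>i. m < i \<and> i < q \<longrightarrow> \<not> R i)" if "R n" for R
      proof -
        define S where "S = {i \<in> {m<..n}. R i}"
        have fin: "finite S" by (rule finite_subset[of _ "{m<..n}"]) (auto simp: S_def)
        have ne: "S \<noteq> {}" using mn that by (auto simp: S_def)
        have "Min S \<in> S" using fin ne by (rule Min_in)
        moreover have "\<not> R i" if "m < i" "i < Min S" for i
        proof
          assume "R i"
          have "Min S \<le> n" using \<open>Min S \<in> S\<close> by (simp add: S_def)
          with that \<open>R i\<close> have "i \<in> S" by (simp add: S_def)
          then have "Min S \<le> i" using fin by simp
          with that show False by simp
        qed
        ultimately show ?thesis by (intro exI[of _ "Min S"]) (auto simp: S_def)
      qed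
      show ?thesis
      proof (cases "x m \<le> x n")
        case True
        obtain q where q: "m < q" "q \<le> n" "x m \<le> x q" "\<forall>i. m < i \<and> i < q \<longrightarrow> \<not> x m \<le> x i"
          using ex[of "\<lambda>i. x m \<le> x i"] True by auto
        have "x (q-1) \<le> x m"
        proof (cases "q - 1 = m")
          case False then show ?thesis using q(1) q(4)[rule_format, of "q-1"] by auto
        qed simp
        then show ?thesis using q True by (intro exI[of _ q]) auto
      next
        case False
        obtain q where q: "m < q" "q \<le> n" "x q \<le> x m" "\<forall>i. m < i \<and> i < q \<longrightarrow> \<not> x i \<le> x m"
          using ex[of "\<lambda>i. x i \<le> x m"] False by auto
        have "x m \<le> x (q-1)"
        proof (cases "q - 1 = m")
          case False then show ?thesis using q(1) q(4)[rule_format, of "q-1"] by auto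
        qed simp
        then show ?thesis using q False by (intro exI[of _ q]) auto
      qed
    qed
    then obtain q where q: "m < q" "q \<le> n"
      and ord: "(x (q-1) \<le> x n \<and> x m \<le> x q) \<or> (x n \<le> x (q-1) \<and> x q \<le> x m)" by blast
    have swap: "e (x (q-1)) (x m) + e (x n) (x q) \<le> e (x (q-1)) (x q) + e (x n) (x m)"
      using ord submod[of "x (q-1)" "x n" "x m" "x q"] submod[of "x n" "x (q-1)" "x q" "x m"]
      by (auto simp: algebra_simps)
    have "(\<Sum>i\<in>{m..q-1}. e (x i) (x i)) \<le> action e x m (q-1) + e (x (q-1)) (x m)"
      using less.hyps[of "q-1" m] q by simp
    moreover have "(\<Sum>i\<in>{q..n}. e (x i) (x i)) \<le> action e x q n + e (x n) (x q)"
      using less.hyps[of n q] q by simp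
    moreover have "(\<Sum>i\<in>{m..n}. e (x i) (x i))
        = (\<Sum>i\<in>{m..q-1}. e (x i) (x i)) + (\<Sum>i\<in>{q..n}. e (x i) (x i))"
    proof -
      have "{m..n} = {m..q-1} \<union> {q..n}" using q by auto
      then show ?thesis by (simp add: sum.union_disjoint)
    qed
    moreover have "action e x m n = action e x m (q-1) + e (x (q-1)) (x q) + action e x q n"
      using action_split[of m q n e x] action_last[of m q e x] q by simp
    ultimately show ?thesis using swap by linarith
  qed
qed

lemma convergent_to_unique_cluster_point:
  fixes y :: "nat \<Rightarrow> 'a::metric_space"
  assumes K: "compact K" "\<And>n. y n \<in> K"
    and cl: "\<And>r l. strict_mono r \<Longrightarrow> l \<in> K \<Longrightarrow> (y \<circ> r) \<longlonglongrightarrow> l \<Longrightarrow> l = a"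
  shows "y \<longlonglongrightarrow> a"
proof (rule ccontr)
  assume "\<not> y \<longlonglongrightarrow> a"
  then obtain d where d: "d > 0" "\<forall>N. \<exists>n\<ge>N. dist (y n) a \<ge> d"
    unfolding lim_sequentially by (auto simp: not_less)
  then have "\<exists>\<^sub>\<infinity>n. dist (y n) a \<ge> d" by (auto simp: INFM_nat_le)
  then have inf: "infinite {n. dist (y n) a \<ge> d}" by (simp add: frequently_cofinite)
  define s where "s = enumerate {n. dist (y n) a \<ge> d}"
  have s: "strict_mono s" "\<And>n. dist (y (s n)) a \<ge> d"
    using strict_mono_enumerate[OF inf] enumerate_in_set[OF inf] by (auto simp: s_def)
  have "seq_compact K" using K(1) by (simp add: compact_eq_seq_compact_metric)
  then obtain l r where l: "l \<in> K" "strict_mono r" "((y \<circ> s) \<circ> r) \<longlonglongrightarrow> l"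
    using K(2) unfolding seq_compact_def by (metis comp_apply)
  have "l = a" using cl[of "s \<circ> r" l] l s(1) by (simp add: strict_mono_o o_assoc)
  moreover have "dist l a \<ge> d"
  proof (rule tendsto_lowerbound)
    show "(\<lambda>n. dist (((y \<circ> s) \<circ> r) n) a) \<longlonglongrightarrow> dist l a" using l(3) by (intro tendsto_intros)
    show "\<forall>\<^sub>F n in sequentially. d \<le> dist (((y \<circ> s) \<circ> r) n) a" using s(2) by simp
  qed simp
  ultimately show False using d by simp
qed

section \<open>Barrier costs between two rest points\<close>

text \<open>
  Chains of length at least one are required, so that \<open>barrier_cost e u0 u1 a a\<close> is the cost of
  a genuine loop and the barrier cost is Lipschitz continuous across the diagonal. The start time is
  arbitrary, which spares all translations of time.
\<close>

definition barrier_cost ::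
    "(real \<Rightarrow> real \<Rightarrow> real) \<Rightarrow> real \<Rightarrow> real \<Rightarrow> real \<Rightarrow> real \<Rightarrow> real" where
  "barrier_cost e u0 u1 a b =
     Inf {action e x m n | x m n. m < n \<and> x \<in> X_space u0 u1 \<and> x m = a \<and> x n = b}"

text \<open>
  The intended \<open>e\<close> is \<open>h\<close> minus its minimum on the diagonal. The assumptions are chosen to be
  invariant under time reversal, that is, under exchanging the arguments of \<open>e\<close>; statements about
  predecessors then give those about successors. The last two are what h4 says about minimal
  triples that share the middle point and one outer point.
\<close>

locale two_well =
  fixes e :: "real \<Rightarrow> real \<Rightarrow> real" and u0 u1 L :: real
  assumes u0_less_u1: "u0 < u1"
    and L_pos: "0 < L"
    and lip1: "\<bar>e a b - e a' b\<bar> \<le> L * \<bar>a - a'\<bar>"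
    and lip2: "\<bar>e a b - e a b'\<bar> \<le> L * \<bar>b - b'\<bar>"
    and submod: "a \<le> a' \<Longrightarrow> b \<le> b' \<Longrightarrow> e a b + e a' b' \<le> e a b' + e a' b"
    and swap_pos: "0 < e u0 u1 + e u1 u0"
    and diag_nonneg: "0 \<le> e a a"
    and diag_pos: "u0 < a \<Longrightarrow> a < u1 \<Longrightarrow> 0 < e a a"
    and diag_u0: "e u0 u0 = 0"
    and diag_u1: "e u1 u1 = 0"
    and unique_left: "(\<And>t. e y z + e z s \<le> e y t + e t s) \<Longrightarrow>
      (\<And>t. e y' z + e z s \<le> e y' t + e t s) \<Longrightarrow> y = y'"
    and unique_right: "(\<And>t. e y z + e z s \<le> e y t + e t s) \<Longrightarrow>
      (\<And>t. e y z + e z s' \<le> e y t + e t s') \<Longrightarrow> s = s'"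
begin

lemma reverse: "two_well (\<lambda>a b. e b a) u0 u1 L"
proof
  show "0 < e u1 u0 + e u0 u1" using swap_pos by simp
  show "e b a + e b' a' \<le> e b' a + e b a'" if "a \<le> a'" "b \<le> b'" for a a' b b'
    using submod[OF that(2,1)] by simp
  show "y = y'" if "\<And>t. e z y + e s z \<le> e t y + e s t" "\<And>t. e z y' + e s z \<le> e t y' + e s t"
    for y y' s z
    by (rule unique_right[of s z y y']) (use that in \<open>simp_all add: add.commute\<close>)
  show "s = s'" if "\<And>t. e z y + e s z \<le> e t y + e s t" "\<And>t. e z y + e s' z \<le> e t y + e s' t"
    for y s s' z
    by (rule unique_left[of s z y s']) (use that in \<open>simp_all add: add.commute\<close>)
qed (use u0_less_u1 L_pos lip1 lip2 diag_nonneg diag_pos diag_u0 diag_u1 in auto)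

abbreviation X where "X \<equiv> X_space u0 u1"
abbreviation D where "D \<equiv> barrier_cost e u0 u1"

lemma ends_in [simp]: "u0 \<in> {u0..u1}" "u1 \<in> {u0..u1}" "u0 \<le> u1"
  using u0_less_u1 by auto

lemma diag_end: "p \<in> {u0, u1} \<Longrightarrow> e p p = 0"
  using diag_u0 diag_u1 by auto

text \<open>
  Close the chain by a step from \<open>x n\<close> back to \<open>x m\<close>, which costs at most
  \<open>e (x n) (x n) + L * \<bar>x n - x m\<bar>\<close>.
\<close>

lemma action_ge_diagonal:
  assumes "m \<le> n"
  shows "(\<Sum>i\<in>{m..<n}. e (x i) (x i)) - L * \<bar>x n - x m\<bar> \<le> action e x m n"
proof -
  have "(\<Sum>i\<in>{m..n}. e (x i) (x i)) \<le> action e x m n + e (x n) (x m)"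
    by (rule cyclic_sum_ge_diagonal[OF submod assms])
  moreover have "{m..n} = insert n {m..<n}" using assms by auto
  then have "(\<Sum>i\<in>{m..n}. e (x i) (x i)) = e (x n) (x n) + (\<Sum>i\<in>{m..<n}. e (x i) (x i))"
    by simp
  moreover have "\<bar>e (x n) (x m) - e (x n) (x n)\<bar> \<le> L * \<bar>x m - x n\<bar>" by (rule lip2)
  ultimately show ?thesis by (simp add: abs_minus_commute abs_le_iff)
qed

lemma action_ge: "m \<le> n \<Longrightarrow> - L * \<bar>x n - x m\<bar> \<le> action e x m n"
  using action_ge_diagonal[of m n x] sum_nonneg[of "{m..<n}" "\<lambda>i. e (x i) (x i)"] diag_nonneg
  by force

lemma dist_le: "a \<in> {u0..u1} \<Longrightarrow> b \<in> {u0..u1} \<Longrightarrow> L * \<bar>a - b\<bar> \<le> L * (u1 - u0)"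
  using L_pos by (intro mult_left_mono) auto

lemma bdd_below_paths:
  "bdd_below {action e x m n | x m n. m < n \<and> x \<in> X \<and> x m = a \<and> x n = b}"
proof (rule bdd_belowI)
  fix v assume "v \<in> {action e x m n | x m n. m < n \<and> x \<in> X \<and> x m = a \<and> x n = b}"
  then obtain x m n where v: "v = action e x m n" "m < n" "x m = a" "x n = b" by auto
  then show "- L * \<bar>b - a\<bar> \<le> v" using action_ge[of m n x] by auto
qed

lemma paths_nonempty:
  assumes "a \<in> {u0..u1}" "b \<in> {u0..u1}"
  shows "{action e x m n | x m n. m < n \<and> x \<in> X \<and> x m = a \<and> x n = b} \<noteq> {}"
proof -
  define x where "x = (\<lambda>i::int. if i \<le> 0 then a else b)"
  have "x \<in> X" "x 0 = a" "x 1 = b" using assms by (auto simp: x_def X_space_def)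
  then have "action e x 0 1 \<in> {action e x m n | x m n. m < n \<and> x \<in> X \<and> x m = a \<and> x n = b}"
    by (intro CollectI exI[of _ x] exI[of _ 0] exI[of _ 1]) auto
  then show ?thesis by blast
qed

lemma D_le: "m < n \<Longrightarrow> x \<in> X \<Longrightarrow> D (x m) (x n) \<le> action e x m n"
  unfolding barrier_cost_def by (rule cInf_lower[OF _ bdd_below_paths]) blast

lemma D_approx:
  assumes "a \<in> {u0..u1}" "b \<in> {u0..u1}" "0 < \<delta>"
  obtains x m n where "m < n" "x \<in> X" "x m = a" "x n = b" "action e x m n < D a b + \<delta>"
proof -
  have "Inf {action e x m n | x m n. m < n \<and> x \<in> X \<and> x m = a \<and> x n = b} < D a b + \<delta>"
    using assms(3) by (simp add: barrier_cost_def)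
  from cInf_lessD[OF paths_nonempty[OF assms(1,2)] this] show ?thesis using that by blast
qed

lemma le_D_I:
  assumes "a \<in> {u0..u1}" "b \<in> {u0..u1}"
    and "\<And>x m n. m < n \<Longrightarrow> x \<in> X \<Longrightarrow> x m = a \<Longrightarrow> x n = b \<Longrightarrow> v \<le> action e x m n"
  shows "v \<le> D a b"
  unfolding barrier_cost_def by (rule cInf_greatest[OF paths_nonempty[OF assms(1,2)]]) (use assms in auto)

lemma D_step1: "a \<in> {u0..u1} \<Longrightarrow> b \<in> {u0..u1} \<Longrightarrow> D a b \<le> e a b"
  using D_le[of 0 1 "\<lambda>i. if i \<le> 0 then a else b"] action_step[of e "\<lambda>i. if i \<le> 0 then a else b" 0]
  by (auto simp: X_space_def)

lemma D_ge: 
  assumes "a \<in> {u0..u1}" "b \<in> {u0..u1}"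
  shows "- L * \<bar>b - a\<bar> \<le> D a b"
  by (rule le_D_I[OF assms]) (use action_ge in force)

text \<open>
  A loop costs at least the diagonal excess of its base point, and the one-step loop attains this.
\<close>

lemma D_self:
  assumes "a \<in> {u0..u1}"
  shows "D a a = e a a"
proof (rule antisym)
  show "e a a \<le> D a a"
  proof (rule le_D_I[OF assms assms])
    fix x m n assume x: "(m::int) < n" "x m = a" "x n = a"
    have "e (x m) (x m) \<le> (\<Sum>i\<in>{m..<n}. e (x i) (x i))"
      using x diag_nonneg by (intro member_le_sum) auto
    then show "e a a \<le> action e x m n" using action_ge_diagonal[of m n x] x by simp
  qed
qed (rule D_step1[OF assms assms])

lemma glue_paths:
  assumes "m \<le> n" "m' \<le> n'" "x \<in> X" "y \<in> X" "x n = y m'"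
  obtains z where "z \<in> X" "z m = x m" "z (n + (n' - m')) = y n'"
    "action e z m (n + (n' - m')) = action e x m n + action e y m' n'"
proof
  define z where "z = (\<lambda>i. if i \<le> n then x i else y (i + (m' - n)))"
  have zy: "z i = y (i + (m' - n))" if "n \<le> i" for i
    using that assms(5) by (cases "i = n") (auto simp: z_def)
  show "z \<in> X" using assms(3,4) by (auto simp: z_def X_space_def)
  show "z m = x m" using assms by (simp add: z_def)
  show "z (n + (n' - m')) = y n'" using assms by (subst zy) auto
  have "action e z m (n + (n' - m')) = action e z m n + action e z n (n + (n' - m'))"
    using assms by (intro action_split) auto
  moreover have "action e z m n = action e x m n" by (rule action_cong) (simp add: z_def)
  moreover have "action e z n (n + (n' - m')) = action e (\<lambda>i. y (i + (m' - n))) n (n + (n' - m'))"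
    by (rule action_cong) (simp add: zy)
  ultimately show "action e z m (n + (n' - m')) = action e x m n + action e y m' n'"
    using action_shift[of e y "m' - n" n "n + (n' - m')"] by simp
qed

lemma D_triangle:
  assumes "a \<in> {u0..u1}" "b \<in> {u0..u1}" "c \<in> {u0..u1}"
  shows "D a c \<le> D a b + D b c"
proof (rule field_le_epsilon)
  fix \<delta> :: real assume "0 < \<delta>"
  then have d: "0 < \<delta> / 2" by simp
  obtain x m n where x: "m < n" "x \<in> X" "x m = a" "x n = b" "action e x m n < D a b + \<delta> / 2"
    by (rule D_approx[OF assms(1,2) d])
  obtain y m' n' where y: "m' < n'" "y \<in> X" "y m' = b" "y n' = c" "action e y m' n' < D b c + \<delta> / 2"
    by (rule D_approx[OF assms(2,3) d])
  obtain z where z: "z \<in> X" "z m = a" "z (n + (n' - m')) = c"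
    "action e z m (n + (n' - m')) = action e x m n + action e y m' n'"
    using glue_paths[of m n m' n' x y] x y by auto
  have "D a c \<le> action e z m (n + (n' - m'))"
    using D_le[of m "n + (n' - m')" z] z x(1) y(1) by simp
  then show "D a c \<le> D a b + D b c + \<delta>" using z x y by simp
qed

lemma D_loop: 
  assumes "a \<in> {u0..u1}" "b \<in> {u0..u1}"
  shows "e a a \<le> D a b + D b a"
  using D_triangle[OF assms(1,2,1)] D_self[OF assms(1)] by simp

lemma D_step:
  assumes "a \<in> {u0..u1}" "y \<in> {u0..u1}" "z \<in> {u0..u1}"
  shows "D a z \<le> D a y + e y z"
  using D_triangle[OF assms] D_step1[OF assms(2,3)] by simp

lemma D_lip1:
  assumes "a \<in> {u0..u1}" "a' \<in> {u0..u1}" "b \<in> {u0..u1}"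
  shows "D a' b \<le> D a b + L * \<bar>a' - a\<bar>"
proof (rule field_le_epsilon)
  fix \<delta> :: real assume d: "0 < \<delta>"
  obtain x m n where x: "m < n" "x \<in> X" "x m = a" "x n = b" "action e x m n < D a b + \<delta>"
    by (rule D_approx[OF assms(1,3) d])
  define y where "y = x(m := a')"
  have "D (y m) (y n) \<le> action e y m n"
    using x assms by (intro D_le) (auto simp: y_def X_space_def)
  moreover have "action e y m n = e a' (x (m + 1)) + action e x (m + 1) n"
    using action_first[OF x(1), of e y] action_cong[of "m+1" n y x e] by (simp add: y_def)
  moreover have "action e x m n = e a (x (m + 1)) + action e x (m + 1) n"
    using action_first[OF x(1), of e x] x by simp
  moreover have "\<bar>e a' (x (m + 1)) - e a (x (m + 1))\<bar> \<le> L * \<bar>a' - a\<bar>" by (rule lip1)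
  ultimately show "D a' b \<le> D a b + L * \<bar>a' - a\<bar> + \<delta>" using x by (simp add: y_def)
qed

lemma D_reverse: "barrier_cost (\<lambda>a b. e b a) u0 u1 a b = D b a"
proof -
  have sub: "{action f x m n | x m n. m < n \<and> x \<in> X \<and> x m = a \<and> x n = b}
    \<subseteq> {action (\<lambda>a b. f b a) x m n | x m n. m < n \<and> x \<in> X \<and> x m = b \<and> x n = a}" for f a b
  proof
    fix v assume "v \<in> {action f x m n | x m n. m < n \<and> x \<in> X \<and> x m = a \<and> x n = b}"
    then obtain x m n where x: "v = action f x m n" "m < n" "x \<in> X" "x m = a" "x n = b" by auto
    show "v \<in> {action (\<lambda>a b. f b a) x m n | x m n. m < n \<and> x \<in> X \<and> x m = b \<and> x n = a}"
      by (intro CollectI exI[of _ "\<lambda>i. x (- i)"] exI[of _ "- n"] exI[of _ "- m"])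
        (use x action_reverse[of f x n m] in \<open>auto simp: X_space_def\<close>)
  qed
  show ?thesis unfolding barrier_cost_def
    by (rule arg_cong[of _ _ Inf], rule antisym) (use sub[of "\<lambda>a b. e b a" a b] sub[of e b a] in auto)
qed

lemma D_lip2:
  assumes "a \<in> {u0..u1}" "b \<in> {u0..u1}" "b' \<in> {u0..u1}"
  shows "D a b' \<le> D a b + L * \<bar>b' - b\<bar>"
  using two_well.D_lip1[OF reverse assms(2,3,1)] by (simp add: D_reverse)

lemma continuous_from_lip:
  fixes g :: "real \<Rightarrow> real"
  assumes "\<And>a b. a \<in> S \<Longrightarrow> b \<in> S \<Longrightarrow> g a \<le> g b + K * \<bar>a - b\<bar>"
  shows "continuous_on S g"
proof (rule lipschitz_on_continuous_on[of "\<bar>K\<bar>"] , rule lipschitz_onI)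
  fix a b assume ab: "a \<in> S" "b \<in> S"
  have "K * \<bar>a - b\<bar> \<le> \<bar>K\<bar> * \<bar>a - b\<bar>" by (intro mult_right_mono) auto
  then show "dist (g a) (g b) \<le> \<bar>K\<bar> * dist a b"
    using assms[OF ab] assms[OF ab(2,1)] by (auto simp: dist_real_def abs_le_iff abs_minus_commute)
qed simp

lemma continuous_D1: "b \<in> {u0..u1} \<Longrightarrow> continuous_on {u0..u1} (\<lambda>a. D a b)"
  by (rule continuous_from_lip[of _ _ L]) (use D_lip1 in blast)

lemma continuous_D2: "a \<in> {u0..u1} \<Longrightarrow> continuous_on {u0..u1} (\<lambda>b. D a b)"
  by (rule continuous_from_lip[of _ _ L]) (use D_lip2 in blast)

lemma continuous_e1: "continuous_on S (\<lambda>a. e a b)"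
  by (rule continuous_from_lip[of _ _ L]) (use lip1[of _ b] in \<open>simp add: abs_le_iff algebra_simps\<close>)

lemma abs_e_diff: "\<bar>e a b - e a' b'\<bar> \<le> L * (\<bar>a - a'\<bar> + \<bar>b - b'\<bar>)"
  using lip1[of a b a'] lip2[of a' b b'] by (simp add: algebra_simps)

lemma tendsto_e:
  fixes f g :: "'x \<Rightarrow> real"
  assumes "(f \<longlongrightarrow> a) F" "(g \<longlongrightarrow> b) F"
  shows "((\<lambda>n. e (f n) (g n)) \<longlongrightarrow> e a b) F"
proof -
  have "((\<lambda>n. e (f n) (g n) - e a b) \<longlongrightarrow> 0) F"
  proof (rule Lim_null_comparison[of _ "\<lambda>n. L * (\<bar>f n - a\<bar> + \<bar>g n - b\<bar>)"])
    show "\<forall>\<^sub>F n in F. norm (e (f n) (g n) - e a b) \<le> L * (\<bar>f n - a\<bar> + \<bar>g n - b\<bar>)"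
      using abs_e_diff by simp
    have "((\<lambda>n. L * (\<bar>f n - a\<bar> + \<bar>g n - b\<bar>)) \<longlongrightarrow> L * (\<bar>a - a\<bar> + \<bar>b - b\<bar>)) F"
      by (intro tendsto_intros assms)
    then show "((\<lambda>n. L * (\<bar>f n - a\<bar> + \<bar>g n - b\<bar>)) \<longlongrightarrow> 0) F" by simp
  qed
  then show ?thesis by (simp add: LIM_zero_iff)
qed

lemma tendsto_D:
  fixes f g :: "nat \<Rightarrow> real"
  assumes "\<And>n. f n \<in> {u0..u1}" "\<And>n. g n \<in> {u0..u1}"
    and "f \<longlonglongrightarrow> a" "g \<longlonglongrightarrow> b"
  shows "(\<lambda>n. D (f n) (g n)) \<longlonglongrightarrow> D a b"
proof -
  have ab: "a \<in> {u0..u1}" "b \<in> {u0..u1}"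
    using closed_sequentially[OF closed_atLeastAtMost] assms by blast+
  have "(\<lambda>n. D (f n) (g n) - D a b) \<longlonglongrightarrow> 0"
  proof (rule Lim_null_comparison[of _ "\<lambda>n. L * (\<bar>f n - a\<bar> + \<bar>g n - b\<bar>)"])
    have "\<bar>D (f n) (g n) - D a b\<bar> \<le> L * (\<bar>f n - a\<bar> + \<bar>g n - b\<bar>)" for n
      using D_lip1[OF ab(1) assms(1)[of n] assms(2)[of n]] D_lip1[OF assms(1)[of n] ab(1) assms(2)[of n]]
        D_lip2[OF ab(1) ab(2) assms(2)[of n]] D_lip2[OF ab(1) assms(2)[of n] ab(2)]
      by (simp add: abs_le_iff abs_minus_commute algebra_simps)
    then show "\<forall>\<^sub>F n in sequentially. norm (D (f n) (g n) - D a b) \<le> L * (\<bar>f n - a\<bar> + \<bar>g n - b\<bar>)"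
      by simp
    have "(\<lambda>n. L * (\<bar>f n - a\<bar> + \<bar>g n - b\<bar>)) \<longlonglongrightarrow> L * (\<bar>a - a\<bar> + \<bar>b - b\<bar>)"
      by (intro tendsto_intros assms)
    then show "(\<lambda>n. L * (\<bar>f n - a\<bar> + \<bar>g n - b\<bar>)) \<longlonglongrightarrow> 0" by simp
  qed
  then show ?thesis by (simp add: LIM_zero_iff)
qed

text \<open>
  Since staying at a rest point \<open>p\<close> is free, a direct step from \<open>p\<close> to \<open>z\<close> also has the form of a
  chain from \<open>p\<close> to some \<open>y\<close> followed by a step to \<open>z\<close>. So \<open>D p z\<close> is the infimum over the last
  point \<open>y\<close>, which is attained by compactness.
\<close>

lemma predecessor_exists:
  assumes "p \<in> {u0, u1}" "z \<in> {u0..u1}"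
  obtains y where "y \<in> {u0..u1}" "D p z = D p y + e y z"
proof -
  have p: "p \<in> {u0..u1}" using assms(1) by auto
  have "continuous_on {u0..u1} (\<lambda>y. D p y + e y z)"
    by (intro continuous_intros continuous_D2 continuous_e1 p)
  then obtain y where y: "y \<in> {u0..u1}" "\<And>t. t \<in> {u0..u1} \<Longrightarrow> D p y + e y z \<le> D p t + e t z"
    using continuous_attains_inf[of "{u0..u1}" "\<lambda>y. D p y + e y z"] by auto
  have "D p y + e y z \<le> D p z"
  proof (rule le_D_I[OF p assms(2)])
    fix x m n assume x: "(m::int) < n" "x \<in> X" "x m = p" "x n = z"
    have xi: "x i \<in> {u0..u1}" for i using x(2) by (auto simp: X_space_def)
    have "D p y + e y z \<le> D p (x (n - 1)) + e (x (n - 1)) z" using y(2) xi by blast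
    also have "\<dots> \<le> action e x m (n - 1) + e (x (n - 1)) z"
    proof (cases "m = n - 1")
      case True
      then show ?thesis using x D_self[OF p] diag_end[OF assms(1)] by simp
    next
      case False
      then show ?thesis using D_le[of m "n - 1" x] x by simp
    qed
    finally show "D p y + e y z \<le> action e x m n" using action_last[OF x(1), of e x] x by simp
  qed
  then show ?thesis using that[of y] y(1) D_step[OF p y(1) assms(2)] by linarith
qed

text \<open>
  By submodularity the pair \<open>max u0 x\<close>, \<open>min u0 x\<close> costs no more than the pair \<open>x\<close>, \<open>u0\<close>. The
  constant \<open>u0\<close> is free, and the loop \<open>min u0 x\<close> based at \<open>u0\<close> has nonnegative excess. The same
  argument applies at \<open>u1\<close>.
\<close>

lemma action_clamp:
  assumes "m \<le> n" "x m \<in> {u0..u1}" "x n \<in> {u0..u1}"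
  shows "action e (\<lambda>i. min u1 (max u0 (x i))) m n \<le> action e x m n"
proof -
  have lat: "e (max a b) (max c d) + e (min a b) (min c d) \<le> e a c + e b d" for a b c d
    using submod[of a b d c] submod[of b a c d] by (auto simp: max_def min_def)
  have sm: "action e (\<lambda>i. max u (y i)) m n + action e (\<lambda>i. min u (y i)) m n
      \<le> action e y m n" if "e u u = 0" for u y
    unfolding action_def sum.distrib[symmetric] by (intro sum_mono) (use lat[of u _ u] that in force)
  have "action e (\<lambda>i. max u0 (x i)) m n \<le> action e x m n"
    using sm[of u0 x] diag_u0 action_ge[OF assms(1), of "\<lambda>i. min u0 (x i)"] assms by simp
  moreover have "action e (\<lambda>i. min u1 (max u0 (x i))) m n \<le> action e (\<lambda>i. max u0 (x i)) m n"
    using sm[of u1 "\<lambda>i. max u0 (x i)"] diag_u1 assms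
      action_ge[OF assms(1), of "\<lambda>i. max u1 (max u0 (x i))"]
    by (simp add: max.absorb1)
  ultimately show ?thesis by simp
qed

lemma clamp_in: "min u1 (max u0 t) \<in> {u0..u1}"
  using u0_less_u1 by auto

lemma clamp_id: "t \<in> {u0..u1} \<Longrightarrow> min u1 (max u0 t) = t"
  by auto

lemma one_site_clamp:
  assumes "y \<in> {u0..u1}" "s \<in> {u0..u1}"
  shows "e y (min u1 (max u0 t)) + e (min u1 (max u0 t)) s \<le> e y t + e t s"
proof -
  define x where "x = (\<lambda>i::int. if i = 0 then y else if i = 1 then t else s)"
  have act: "action e z 0 2 = e (z 0) (z 1) + e (z 1) (z 2)" for z
    using action_first[of 0 2 e z] action_first[of 1 2 e z] by simp
  have "action e (\<lambda>i. min u1 (max u0 (x i))) 0 2 \<le> action e x 0 2"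
    by (rule action_clamp) (use assms in \<open>auto simp: x_def\<close>)
  then show ?thesis using assms by (simp add: act x_def)
qed

text \<open>
  The extra cost of a passage from \<open>p\<close> to \<open>q\<close> that is forced to go through \<open>y\<close>.
\<close>

definition defect where "defect p q y = D p y + D y q - D p q"

lemma defect_nonneg:
  "p \<in> {u0..u1} \<Longrightarrow> q \<in> {u0..u1} \<Longrightarrow> y \<in> {u0..u1} \<Longrightarrow> 0 \<le> defect p q y"
  using D_triangle[of p y q] by (simp add: defect_def)

lemma continuous_defect:
  "p \<in> {u0..u1} \<Longrightarrow> q \<in> {u0..u1} \<Longrightarrow> continuous_on {u0..u1} (defect p q)"
  unfolding defect_def by (intro continuous_intros continuous_D1 continuous_D2)

definition tight where "tight p q = {y \<in> {u0..u1}. defect p q y = 0}"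

lemma tight_ends:
  assumes "p \<in> {u0, u1}" "q \<in> {u0, u1}"
  shows "p \<in> tight p q" "q \<in> tight p q"
  using assms D_self diag_end by (auto simp: tight_def defect_def)

lemma closed_tight: 
  assumes "p \<in> {u0, u1}" "q \<in> {u0, u1}"
  shows "closed (tight p q)"
proof -
  have "closed ({u0..u1} \<inter> defect p q -` {0})"
    using assms by (intro continuous_closed_preimage continuous_defect) auto
  moreover have "{u0..u1} \<inter> defect p q -` {0} = tight p q" by (auto simp: tight_def)
  ultimately show ?thesis by simp
qed

text \<open>
  The point \<open>y\<close> is an optimal predecessor of \<open>z\<close> for chains that start at \<open>p\<close>.
\<close>

definition calibrated where
  "calibrated p y z \<longleftrightarrow> y \<in> {u0..u1} \<and> D p z = D p y + e y z"

lemma calibrated_tight: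
  assumes "p \<in> {u0, u1}" "q \<in> {u0, u1}" "z \<in> tight p q" "calibrated p y z"
  shows "y \<in> tight p q"
proof -
  have i: "p \<in> {u0..u1}" "q \<in> {u0..u1}" "y \<in> {u0..u1}" "z \<in> {u0..u1}"
    using assms by (auto simp: tight_def calibrated_def)
  have "D y q \<le> e y z + D z q" using D_triangle[of y z q] D_step1[of y z] i by simp
  then have "defect p q y \<le> 0" using assms by (simp add: defect_def tight_def calibrated_def)
  then show ?thesis using defect_nonneg[of p q y] i by (simp add: tight_def)
qed

text \<open>
  Time reversal turns successors towards \<open>q\<close> into predecessors. On the zero set of the defect,
  optimality towards \<open>q\<close> and optimality from \<open>p\<close> are the same.
\<close>

lemma successor_exists:
  assumes "p \<in> {u0, u1}" "q \<in> {u0, u1}" "z \<in> tight p q"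
  obtains s where "s \<in> tight p q" "D z q = e z s + D s q" "calibrated p z s"
proof -
  have i: "p \<in> {u0..u1}" "q \<in> {u0..u1}" "z \<in> {u0..u1}"
    using assms by (auto simp: tight_def)
  obtain s where s: "s \<in> {u0..u1}" "D z q = e z s + D s q"
    using two_well.predecessor_exists[OF reverse assms(2) i(3)]
    by (auto simp: D_reverse add.commute)
  have "D p s \<le> D p z + e z s" using D_step i s by blast
  then have "defect p q s \<le> 0" using s assms(3) by (simp add: defect_def tight_def)
  then have "s \<in> tight p q" using defect_nonneg[of p q s] i s by (simp add: tight_def)
  moreover have "calibrated p z s"
    using s \<open>s \<in> tight p q\<close> assms(3) by (simp add: calibrated_def tight_def defect_def)
  ultimately show ?thesis using that s by blast
qed

text \<open>
  On the zero set, \<open>z\<close> has an optimal successor \<open>s\<close>, and \<open>(y, z, s)\<close> is minimal for every optimal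
  predecessor \<open>y\<close>: a cheaper middle point, clamped to \<open>[u0, u1]\<close>, would give a passage from \<open>p\<close> to
  \<open>q\<close> that is cheaper than \<open>D p q\<close>. Two minimal triples that share \<open>z\<close> and \<open>s\<close> agree.
\<close>

lemma calibrated_unique:
  assumes "p \<in> {u0, u1}" "q \<in> {u0, u1}" "z \<in> tight p q" "calibrated p y z" "calibrated p y' z"
  shows "y = y'"
proof -
  obtain s where s: "s \<in> tight p q" "D z q = e z s + D s q"
    using successor_exists[OF assms(1-3)] by blast
  have i: "p \<in> {u0..u1}" "q \<in> {u0..u1}" "z \<in> {u0..u1}" "s \<in> {u0..u1}"
    using assms s by (auto simp: tight_def)
  have "e y z + e z s \<le> e y t + e t s" if y: "calibrated p y z" for y t
  proof -
    have yi: "y \<in> {u0..u1}" using y by (simp add: calibrated_def)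
    define t' where "t' = min u1 (max u0 t)"
    have t': "t' \<in> {u0..u1}" unfolding t'_def by (rule clamp_in)
    have "D p q \<le> D p t' + D t' q" using D_triangle i t' by blast
    also have "D p t' \<le> D p y + e y t'" using D_step i yi t' by blast
    also have "D t' q \<le> e t' s + D s q"
      using D_triangle[of t' s q] D_step1[of t' s] i t' by simp
    finally have "D p q \<le> D p y + e y t' + (e t' s + D s q)" by simp
    moreover have "D p q = D p y + e y z + e z s + D s q"
      using assms(3) s y by (simp add: tight_def defect_def calibrated_def)
    moreover have "e y t' + e t' s \<le> e y t + e t s"
      unfolding t'_def by (rule one_site_clamp[OF yi i(4)])
    ultimately show ?thesis by simp
  qed
  then show ?thesis using assms unique_left by blast
qed

text \<open>
  The excess along the orbit telescopes and stays bounded, so the diagonal excesses are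
  summable and the orbit can only accumulate at the rest points. If it accumulated at \<open>q\<close>, a passage
  from \<open>q\<close> through \<open>z\<close> back to \<open>q\<close> would cost at most the defect of \<open>z\<close>, which is zero, although
  every loop through \<open>z\<close> costs at least \<open>e z z > 0\<close>. If \<open>z = p\<close>, the orbit is constant by uniqueness.
\<close>

lemma backward_orbit_tendsto:
  assumes pq: "p \<in> {u0, u1}" "q \<in> {u0, u1}" "p \<noteq> q"
    and z: "z \<in> tight p q" "z \<noteq> q"
    and y: "y 0 = z" "\<And>n. calibrated p (y (Suc n)) (y n)"
  shows "y \<longlonglongrightarrow> p"
proof -
  have pi: "p \<in> {u0..u1}" "q \<in> {u0..u1}" "z \<in> {u0..u1}" using pq z by (auto simp: tight_def)
  have yt: "y n \<in> tight p q" for n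
    by (induction n) (use z y calibrated_tight[OF pq(1,2)] in auto)
  have yi: "y n \<in> {u0..u1}" for n using yt by (simp add: tight_def)
  have yseq: "D p z - D p (y n) = (\<Sum>i<n. e (y (Suc i)) (y i))" for n
  proof (induction n)
    case (Suc n)
    then show ?case using y(2)[of n] by (simp add: calibrated_def)
  qed (simp add: y)
  define x where "x = (\<lambda>i::int. y (nat (- i)))"
  have xX: "x \<in> X" using yi by (simp add: x_def X_space_def)
  have act: "action e x (- int n) 0 = D p z - D p (y n)" for n
    unfolding yseq action_def
    by (rule sum.reindex_bij_witness[where i = "\<lambda>i. - int i - 1" and j = "\<lambda>i. nat (- i - 1)"])
      (auto simp: x_def nat_diff_distrib intro!: arg_cong2[of _ _ _ _ e] arg_cong[of _ _ y])
  have x0: "x 0 = z" by (simp add: x_def y)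
  have xn: "x (- int n) = y n" for n by (simp add: x_def)
  have Dle: "D (y n) z \<le> D p z - D p (y n)" if "n > 0" for n
    using D_le[of "- int n" 0 x] that xX act[of n] x0 xn by simp
  show ?thesis
  proof (cases "z = p")
    case True
    have "calibrated p p p" using pi diag_end[OF pq(1)] by (simp add: calibrated_def)
    then have "y n = p" for n
    proof (induction n)
      case (Suc n)
      then show ?case
        using calibrated_unique[OF pq(1,2) tight_ends(1)[OF pq(1,2)], of "y (Suc n)" p] y(2)[of n] by simp
    qed (simp add: y True)
    then have "y = (\<lambda>_. p)" by auto
    then show ?thesis by simp
  next
    case False
    then have zpos: "0 < e z z" using pq z pi diag_pos[of z] by auto
    define K where "K = D p z + L * (u1 - u0) + L * (u1 - u0)"
    have bound: "(\<Sum>i\<in>{1..n}. e (y i) (y i)) \<le> K" for n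
    proof -
      have "(\<Sum>i\<in>{1..n}. e (y i) (y i)) = (\<Sum>i\<in>{- int n..<0}. e (x i) (x i))"
        by (rule sum.reindex_bij_witness[where j = "\<lambda>i. - int i" and i = "\<lambda>i. nat (- i)"])
          (auto simp: x_def)
      also have "\<dots> \<le> action e x (- int n) 0 + L * \<bar>x 0 - x (- int n)\<bar>"
        using action_ge_diagonal[of "- int n" 0 x] by simp
      also have "\<dots> \<le> (D p z - D p (y n)) + L * (u1 - u0)"
        using dist_le[of "x 0" "x (- int n)"] pi yi act[of n] x0 xn by simp
      finally show ?thesis
        using D_ge[OF pi(1) yi[of n]] dist_le[OF yi[of n] pi(1)] by (simp add: K_def)
    qed
    have "summable (\<lambda>i. e (y (Suc i)) (y (Suc i)))"
    proof (rule summableI_nonneg_bounded)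
      show "(\<Sum>i<n. e (y (Suc i)) (y (Suc i))) \<le> K" for n
        using bound[of n] sum.atLeast_Suc_atMost_Suc_shift[of "\<lambda>i. e (y i) (y i)" 0 "n - 1"]
        by (cases n) (simp_all add: lessThan_Suc_atMost atLeast0AtMost K_def[symmetric]
              sum.atLeast1_atMost_eq)
    qed (rule diag_nonneg)
    then have w0: "(\<lambda>n. e (y n) (y n)) \<longlonglongrightarrow> 0"
      using summable_LIMSEQ_zero filterlim_sequentially_Suc[of "\<lambda>i. e (y i) (y i)"] by blast
    show ?thesis
    proof (rule convergent_to_unique_cluster_point[of "{u0..u1}"])
      fix r l assume r: "strict_mono r" "l \<in> {u0..u1}" "(y \<circ> r) \<longlonglongrightarrow> l"
      have "(\<lambda>n. e ((y \<circ> r) n) ((y \<circ> r) n)) \<longlonglongrightarrow> e l l" by (rule tendsto_e[OF r(3) r(3)])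
      moreover have "(\<lambda>n. e ((y \<circ> r) n) ((y \<circ> r) n)) \<longlonglongrightarrow> 0"
        using LIMSEQ_subseq_LIMSEQ[OF w0 r(1)] by (simp add: o_def)
      ultimately have "e l l = 0" by (rule LIMSEQ_unique)
      then have l: "l \<in> {u0, u1}" using diag_pos[of l] r(2) by force
      show "l = p"
      proof (rule ccontr)
        assume "l \<noteq> p"
        with l pq have lq: "l = q" by auto
        have "D q z \<le> D p z - D p q"
        proof (rule LIMSEQ_le)
          show "(\<lambda>n. D ((y \<circ> r) n) z) \<longlonglongrightarrow> D q z"
            by (rule tendsto_D) (use yi r(3) lq pi in \<open>auto simp: o_def\<close>)
          have "(\<lambda>n. D p ((y \<circ> r) n)) \<longlonglongrightarrow> D p q"
            by (rule tendsto_D) (use yi r(3) lq pi in \<open>auto simp: o_def\<close>)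
          then show "(\<lambda>n. D p z - D p ((y \<circ> r) n)) \<longlonglongrightarrow> D p z - D p q"
            by (intro tendsto_intros)
          have "D ((y \<circ> r) n) z \<le> D p z - D p ((y \<circ> r) n)" if "n \<ge> 1" for n
            using Dle[of "r n"] seq_suble[OF r(1), of n] that by simp
          then show "\<exists>N. \<forall>n\<ge>N. D ((y \<circ> r) n) z \<le> D p z - D p ((y \<circ> r) n)" by blast
        qed
        moreover have "e z z \<le> D z q + D q z" by (rule D_loop[OF pi(3,2)])
        ultimately show False using z(1) zpos by (simp add: tight_def defect_def)
      qed
    qed (use yi in auto)
  qed
qed

end

section \<open>Minimal heteroclinic configurations and points of positive defect\<close>

context two_well
begin

lemma defect_reverse: "two_well.defect (\<lambda>a b. e b a) u0 u1 q p y = defect p q y"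
  by (simp add: two_well.defect_def[OF reverse] defect_def D_reverse)

lemma tight_reverse: "two_well.tight (\<lambda>a b. e b a) u0 u1 q p = tight p q"
  by (simp add: two_well.tight_def[OF reverse] tight_def defect_reverse)

lemma calibrated_reverse:
  "two_well.calibrated (\<lambda>a b. e b a) u0 u1 q y z \<longleftrightarrow> y \<in> {u0..u1} \<and> D z q = e z y + D y q"
  by (auto simp: two_well.calibrated_def[OF reverse] D_reverse)

lemma backward_orbit_exists:
  assumes "p \<in> {u0, u1}" "q \<in> {u0, u1}" "z \<in> tight p q"
  obtains y where "y 0 = z" "\<And>n. y n \<in> tight p q" "\<And>n. calibrated p (y (Suc n)) (y n)"
proof -
  have "\<exists>y. calibrated p y t" if "t \<in> tight p q" for t
    using predecessor_exists[OF assms(1), of t] that by (auto simp: tight_def calibrated_def)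
  then have "\<exists>y. y \<in> tight p q \<and> calibrated p y t" if "t \<in> tight p q" for t
    using calibrated_tight[OF assms(1,2) that] that by blast
  then obtain P where P: "\<And>t. t \<in> tight p q \<Longrightarrow> P t \<in> tight p q \<and> calibrated p (P t) t"
    by metis
  define y where "y n = (P ^^ n) z" for n
  have t: "y n \<in> tight p q" for n by (induction n) (use assms P in \<open>auto simp: y_def\<close>)
  have "calibrated p (y (Suc n)) (y n)" for n using P[OF t[of n]] by (simp add: y_def)
  with t show ?thesis using that[of y] by (auto simp: y_def)
qed

text \<open>
  The relation of being an optimal predecessor is closed, and it is single-valued on the zero set of
  the defect; in a compact interval this gives continuity.
\<close>

lemma predecessor_map:
  assumes pq: "p \<in> {u0, u1}" "q \<in> {u0, u1}" "p \<noteq> q"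
  obtains P where "\<And>z. z \<in> tight p q \<Longrightarrow> calibrated p (P z) z"
    "continuous_on (tight p q) P" "P ` tight p q \<subseteq> tight p q" "P q = q"
proof -
  have pi: "p \<in> {u0..u1}" "q \<in> {u0..u1}" using pq by auto
  have "\<exists>y. calibrated p y t" if "t \<in> tight p q" for t
    using predecessor_exists[OF pq(1), of t] that by (auto simp: tight_def calibrated_def)
  then obtain P where P: "\<And>z. z \<in> tight p q \<Longrightarrow> calibrated p (P z) z"
    by metis
  have Pin: "P z \<in> {u0..u1}" if "z \<in> tight p q" for z using P[OF that] by (simp add: calibrated_def)
  have "continuous_on (tight p q) P"
    unfolding continuous_on_sequentially
  proof (intro ballI allI impI)
    fix z x assume z: "z \<in> tight p q" and x: "(\<forall>n. x n \<in> tight p q) \<and> x \<longlonglongrightarrow> z"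
    have xi: "x n \<in> {u0..u1}" for n using x by (auto simp: tight_def)
    show "(P \<circ> x) \<longlonglongrightarrow> P z"
    proof (rule convergent_to_unique_cluster_point[of "{u0..u1}"])
      show "(P \<circ> x) n \<in> {u0..u1}" for n using Pin x by simp
      fix r l assume r: "strict_mono r" "l \<in> {u0..u1}" "((P \<circ> x) \<circ> r) \<longlonglongrightarrow> l"
      have xr: "(x \<circ> r) \<longlonglongrightarrow> z" using x r(1) LIMSEQ_subseq_LIMSEQ by blast
      have "(\<lambda>n. D p ((x \<circ> r) n)) \<longlonglongrightarrow> D p z"
        by (rule tendsto_D) (use xi pi xr in \<open>auto simp: o_def\<close>)
      moreover have "(\<lambda>n. D p (((P \<circ> x) \<circ> r) n) + e (((P \<circ> x) \<circ> r) n) ((x \<circ> r) n))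
          \<longlonglongrightarrow> D p l + e l z"
        by (intro tendsto_add tendsto_D tendsto_e) (use Pin x pi xr r(2,3) in \<open>auto simp: o_def\<close>)
      moreover have "D p ((x \<circ> r) n) = D p (((P \<circ> x) \<circ> r) n) + e (((P \<circ> x) \<circ> r) n) ((x \<circ> r) n)" for n
        using P[of "x (r n)"] x by (simp add: calibrated_def)
      ultimately have "D p z = D p l + e l z" using LIMSEQ_unique by simp
      then have "calibrated p l z" using r(2) by (simp add: calibrated_def)
      then show "l = P z" using calibrated_unique[OF pq(1,2) z] P[OF z] by blast
    qed simp
  qed
  moreover have "P ` tight p q \<subseteq> tight p q" using calibrated_tight[OF pq(1,2)] P by blast
  moreover have "P q = q"
  proof -
    have "calibrated p q q" using pi diag_end[OF pq(2)] by (simp add: calibrated_def)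
    then show ?thesis using calibrated_unique[OF pq(1,2) tight_ends(2)[OF pq(1,2)]]
      P[OF tight_ends(2)[OF pq(1,2)]] by blast
  qed
  ultimately show ?thesis using that P by blast
qed

text \<open>
  Let \<open>C\<close> be the component of \<open>q\<close> in the zero set of the defect. Taking predecessors is continuous
  and fixes \<open>q\<close>, so it maps \<open>C\<close> into itself. If \<open>C\<close> contains a point other than \<open>q\<close>, then the
  iterated predecessors of that point converge to \<open>p\<close>, so the closed connected set \<open>C\<close> contains both
  rest points and hence \<open>y0\<close>, where the defect is positive. Therefore \<open>C = {q}\<close>, and no interval
  next to \<open>q\<close> lies in the zero set.
\<close>

lemma defect_pos_near_target:
  assumes pq: "p \<in> {u0, u1}" "q \<in> {u0, u1}" "p \<noteq> q"
    and gap: "y0 \<in> {u0..u1}" "0 < defect p q y0" and "0 < \<delta>"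
  obtains y where "u0 < y" "y < u1" "\<bar>y - q\<bar> < \<delta>" "0 < defect p q y"
proof -
  let ?Z = "tight p q"
  obtain P where P: "\<And>z. z \<in> ?Z \<Longrightarrow> calibrated p (P z) z"
    "continuous_on ?Z P" "P ` ?Z \<subseteq> ?Z" "P q = q"
    using predecessor_map[OF pq] by blast
  define C where "C = connected_component_set ?Z q"
  have qZ: "q \<in> ?Z" by (rule tight_ends(2)[OF pq(1,2)])
  have qC: "q \<in> C" using qZ by (simp add: C_def connected_component_refl)
  have CZ: "C \<subseteq> ?Z" unfolding C_def by (rule connected_component_subset)
  have Cconn: "connected C" by (simp add: C_def connected_connected_component)
  have Cclosed: "closed C" unfolding C_def
    by (rule closed_connected_component[OF closed_tight[OF pq(1,2)]])
  have PC: "P ` C \<subseteq> C"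
  proof -
    have "connected (P ` C)" using P(2) CZ Cconn
      by (meson connected_continuous_image continuous_on_subset)
    moreover have "q \<in> P ` C" using P(4) qC by force
    moreover have "P ` C \<subseteq> ?Z" using P(3) CZ by blast
    ultimately show ?thesis unfolding C_def by (intro connected_component_maximal)
  qed
  have Cq: "C = {q}"
  proof (rule ccontr)
    assume "C \<noteq> {q}"
    with qC obtain z where z: "z \<in> C" "z \<noteq> q" by blast
    define y where "y n = (P ^^ n) z" for n
    have yC: "y n \<in> C" for n by (induction n) (use z PC in \<open>auto simp: y_def\<close>)
    have "y \<longlonglongrightarrow> p"
    proof (rule backward_orbit_tendsto[OF pq])
      show "calibrated p (y (Suc n)) (y n)" for n
        using P(1) CZ yC[of n] by (auto simp: y_def)
    qed (use z CZ in \<open>auto simp: y_def\<close>)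
    then have "p \<in> C" using closed_sequentially[OF Cclosed] yC by blast
    then have "{u0..u1} \<subseteq> C" using qC pq connected_contains_Icc[OF Cconn, of u0 u1] by auto
    then have "y0 \<in> ?Z" using gap(1) CZ by blast
    then show False using gap(2) by (simp add: tight_def)
  qed
  define r where "r = min (\<delta> / 2) ((u1 - u0) / 2)"
  have r: "0 < r" "r < \<delta>" "r < u1 - u0" using \<open>0 < \<delta>\<close> u0_less_u1 by (auto simp: r_def min_def)
  define b where "b = (if q = u0 then u0 + r else u1 - r)"
  have b: "b \<noteq> q" "closed_segment q b \<subseteq> {u0..u1}" "\<And>t. t \<in> closed_segment q b \<Longrightarrow> \<bar>t - q\<bar> < \<delta> \<and> t \<noteq> p"
    using pq r by (auto simp: b_def closed_segment_eq_real_ivl split: if_splits)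
  have "\<not> closed_segment q b \<subseteq> ?Z"
  proof
    assume "closed_segment q b \<subseteq> ?Z"
    then have "closed_segment q b \<subseteq> C" unfolding C_def
      by (intro connected_component_maximal) auto
    then have "b \<in> C" by auto
    with Cq b(1) show False by simp
  qed
  then obtain t where t: "t \<in> closed_segment q b" "t \<notin> ?Z" by blast
  have ti: "t \<in> {u0..u1}" using t(1) b(2) by blast
  have "t \<noteq> q" "t \<noteq> p" using t qZ b(3) by auto
  then have "t \<noteq> u0" "t \<noteq> u1" using pq by auto
  then have "u0 < t" "t < u1" using ti by auto
  moreover have "0 < defect p q t"
    using t ti defect_nonneg[of p q t] pq by (auto simp: tight_def less_le)
  ultimately show ?thesis using that[of t] b(3)[OF t(1)] by blast
qed

text \<open>
  Time reversal exchanges source and target.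
\<close>

lemma defect_pos_near_source:
  assumes pq: "p \<in> {u0, u1}" "q \<in> {u0, u1}" "p \<noteq> q"
    and gap: "y0 \<in> {u0..u1}" "0 < defect p q y0" and "0 < \<delta>"
  obtains y where "u0 < y" "y < u1" "\<bar>y - p\<bar> < \<delta>" "0 < defect p q y"
proof (rule two_well.defect_pos_near_target[OF reverse pq(2,1) pq(3)[symmetric] gap(1) _ \<open>0 < \<delta>\<close>])
  show "0 < two_well.defect (\<lambda>a b. e b a) u0 u1 q p y0" using gap by (simp add: defect_reverse)
qed (use that in \<open>simp add: defect_reverse\<close>)

text \<open>
  Iterated predecessors of \<open>z\<close> converge to \<open>p\<close>, iterated successors to \<open>q\<close>. Along the resulting
  configuration the excess is the increment of \<open>D p\<close>, and no chain between the same end points can be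
  cheaper than this increment. Competitors that leave \<open>[u0, u1]\<close> are clamped first.
\<close>

lemma tight_heteroclinic:
  assumes pq: "p \<in> {u0, u1}" "q \<in> {u0, u1}" "p \<noteq> q" and z: "z \<in> tight p q" "z \<noteq> p" "z \<noteq> q"
  obtains x where "x 0 = z" "x \<in> X" "(x \<longlongrightarrow> p) at_bot" "(x \<longlongrightarrow> q) at_top" 
    "\<And>m n y. m \<le> n \<Longrightarrow> y m = x m \<Longrightarrow> y n = x n \<Longrightarrow> action e x m n \<le> action e y m n"
proof -
  obtain y where y: "y 0 = z" "\<And>n. y n \<in> tight p q" "\<And>n. calibrated p (y (Suc n)) (y n)"
    using backward_orbit_exists[OF pq(1,2) z(1)] by blast
  obtain s where s: "s 0 = z" "\<And>n. s n \<in> tight p q"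
      "\<And>n. two_well.calibrated (\<lambda>a b. e b a) u0 u1 q (s (Suc n)) (s n)"
    using two_well.backward_orbit_exists[OF reverse pq(2,1), of z] z(1) by (auto simp: tight_reverse)
  have yp: "y \<longlonglongrightarrow> p" by (rule backward_orbit_tendsto[OF pq z(1,3) y(1,3)])
  have sq: "s \<longlonglongrightarrow> q"
    by (rule two_well.backward_orbit_tendsto[OF reverse pq(2,1) pq(3)[symmetric] _ z(2) s(1,3)])
      (simp add: tight_reverse z)
  have scal: "calibrated p (s n) (s (Suc n))" for n
  proof -
    have "D (s n) q = e (s n) (s (Suc n)) + D (s (Suc n)) q" 
      using s(3)[of n] by (simp add: calibrated_reverse)
    then show ?thesis using s(2)[of n] s(2)[of "Suc n"]
      by (simp add: calibrated_def tight_def defect_def)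
  qed
  define x where "x = (\<lambda>i::int. if i \<le> 0 then y (nat (- i)) else s (nat i))"
  have xs: "x i = s (nat i)" if "0 \<le> i" for i
    using that y s by (cases "i = 0") (auto simp: x_def)
  have xt: "x i \<in> tight p q" for i using y s by (simp add: x_def)
  have xX: "x \<in> X" using xt by (auto simp: X_space_def tight_def)
  have xcal: "D p (x (i + 1)) = D p (x i) + e (x i) (x (i + 1))" for i
  proof (cases "0 \<le> i")
    case True
    then have "x i = s (nat i)" "x (i + 1) = s (Suc (nat i))"
      using xs[of i] xs[of "i+1"] by (auto simp: Suc_nat_eq_nat_zadd1 add.commute)
    then show ?thesis using scal[of "nat i"] by (simp add: calibrated_def)
  next
    case False
    then have "x i = y (Suc (nat (- i - 1)))" "x (i + 1) = y (nat (- i - 1))"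
      by (auto simp: x_def Suc_nat_eq_nat_zadd1 intro!: arg_cong[of _ _ y])
    then show ?thesis using y(3)[of "nat (- i - 1)"] by (simp add: calibrated_def)
  qed
  have xact: "action e x m n = D p (x n) - D p (x m)" if "m \<le> n" for m n
    using that
  proof (induction n rule: int_ge_induct)
    case (step i)
    then show ?case using xcal[of i] action_split[of m i "i+1" e x] by simp
  qed simp
  have xbot: "(x \<longlongrightarrow> p) at_bot"
  proof -
    have "filterlim (\<lambda>i::int. nat (- i)) at_top at_bot"
      unfolding filterlim_at_top eventually_at_bot_linorder
    proof
      fix N :: nat
      show "\<exists>K. \<forall>i\<le>K. N \<le> nat (- i)" by (intro exI[of _ "- int N"]) auto
    qed
    from filterlim_compose[OF yp this] have "((\<lambda>i. y (nat (- i))) \<longlongrightarrow> p) at_bot" .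
    moreover have "\<forall>\<^sub>F i in at_bot. x i = y (nat (- i))"
      unfolding eventually_at_bot_linorder by (intro exI[of _ 0]) (simp add: x_def)
    ultimately show ?thesis by (simp add: tendsto_cong)
  qed
  have xtop: "(x \<longlongrightarrow> q) at_top"
  proof -
    from filterlim_compose[OF sq filterlim_nat_sequentially]
    have "((\<lambda>i. s (nat i)) \<longlongrightarrow> q) at_top" .
    moreover have "\<forall>\<^sub>F i in at_top. x i = s (nat i)"
      unfolding eventually_at_top_linorder by (intro exI[of _ 0]) (simp add: xs)
    ultimately show ?thesis by (simp add: tendsto_cong)
  qed
  have "action e x m n \<le> action e v m n" if v: "m \<le> n" "v m = x m" "v n = x n" for m n v
  proof (cases "m = n")
    case False
    have xi: "x i \<in> {u0..u1}" for i using xX by (auto simp: X_space_def)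
    have pi: "p \<in> {u0..u1}" using pq by auto
    let ?c = "\<lambda>i. min u1 (max u0 (v i))"
    have "?c \<in> X" using clamp_in by (auto simp: X_space_def)
    moreover have "?c m = x m" "?c n = x n" using v clamp_id xi by simp_all
    ultimately have "D (x m) (x n) \<le> action e ?c m n" using D_le[of m n ?c] v False by simp
    also have "\<dots> \<le> action e v m n" by (rule action_clamp) (use v xi in auto)
    finally show ?thesis using D_triangle[of p "x m" "x n"] pi xi xact[OF v(1)] by simp
  qed simp
  then show ?thesis using that[of x] xX xbot xtop xt by (simp add: x_def y)
qed

text \<open>
  A chain that stays close to the two rest points must jump from one to the other in one step.
\<close>

lemma one_sided_transition:
  assumes pq: "p \<in> {u0, u1}" "q \<in> {u0, u1}" "p \<noteq> q"
    and \<eta>: "0 < \<eta>" "2 * \<eta> < u1 - u0"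
    and x: "m < n" "x \<in> X" "x m = p" "x n = q"
    and avoid: "\<And>i. m \<le> i \<Longrightarrow> i \<le> n \<Longrightarrow> \<bar>x i - p\<bar> < \<eta> \<or> \<bar>x i - q\<bar> < \<eta>"
  shows "e p q - 4 * L * \<eta> \<le> action e x m n"
proof -
  have far: "\<bar>t - p\<bar> < \<eta> \<Longrightarrow> \<not> \<bar>t - q\<bar> < \<eta>" for t using pq \<eta> by (auto simp: abs_less_iff)
  have "\<exists>i. m \<le> i \<and> i < n \<and> \<bar>x i - p\<bar> < \<eta> \<and> \<bar>x (i + 1) - q\<bar> < \<eta>"
  proof (rule ccontr)
    assume neg: "\<not> ?thesis"
    have "m \<le> j \<Longrightarrow> j \<le> n \<longrightarrow> \<bar>x j - p\<bar> < \<eta>" for j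
    proof (induction j rule: int_ge_induct)
      case (step i)
      then show ?case using neg avoid[of "i + 1"] by force
    qed (use x \<eta> in simp)
    from this[of n] show False using far[of "x n"] x \<eta> by simp
  qed
  then obtain i where i: "m \<le> i" "i < n" "\<bar>x i - p\<bar> < \<eta>" "\<bar>x (i + 1) - q\<bar> < \<eta>" by blast
  have "action e x m n = action e x m i + e (x i) (x (i + 1)) + action e x (i + 1) n"
    using action_split[of m i n e x] action_first[of i n e x] i by simp
  moreover have "- (L * \<bar>x i - p\<bar>) \<le> action e x m i" using action_ge[of m i x] i x by simp
  moreover have "- (L * \<bar>x (i+1) - q\<bar>) \<le> action e x (i + 1) n"
    using action_ge[of "i+1" n x] i x by (simp add: abs_minus_commute)
  moreover have "\<bar>e (x i) (x (i + 1)) - e p q\<bar> \<le> L * (\<bar>x i - p\<bar> + \<bar>x (i + 1) - q\<bar>)"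
    by (rule abs_e_diff)
  moreover have "L * \<bar>x i - p\<bar> \<le> L * \<eta>" "L * \<bar>x (i + 1) - q\<bar> \<le> L * \<eta>"
    using i L_pos by auto
  ultimately show ?thesis by (simp add: algebra_simps abs_le_iff)
qed

lemma diag_lower_bound:
  assumes "0 < \<eta>" 
  obtains \<mu> where "0 < \<mu>" "\<And>t. t \<in> {u0..u1} \<Longrightarrow> \<not> \<bar>t - u0\<bar> < \<eta> \<Longrightarrow> \<not> \<bar>t - u1\<bar> < \<eta> \<Longrightarrow> \<mu> \<le> e t t"
proof (cases "{u0 + \<eta>..u1 - \<eta>} = {}")
  case True
  then show ?thesis using that[of 1] by (auto simp: abs_less_iff)
next
  case False
  have "continuous_on {u0 + \<eta>..u1 - \<eta>} (\<lambda>t. e t t)"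
    by (rule continuous_from_lip[of _ _ "2 * L"]) (use abs_e_diff[of a a b b for a b] in \<open>simp add: abs_le_iff algebra_simps\<close>)
  then obtain y where y: "y \<in> {u0 + \<eta>..u1 - \<eta>}" "\<And>t. t \<in> {u0 + \<eta>..u1 - \<eta>} \<Longrightarrow> e y y \<le> e t t"
    using continuous_attains_inf[OF compact_Icc False] by blast
  have "0 < e y y" using diag_pos[of y] y assms by simp
  then show ?thesis using that[of "e y y"] y by (auto simp: abs_less_iff)
qed

text \<open>
  A passage either visits a point away from the rest points, and then the round trip contains
  a loop of definite cost, or it jumps across. Two jumps, one in each direction, cost about
  \<open>e u0 u1 + e u1 u0\<close>, which is positive.
\<close>

lemma round_trip_pos: "0 < D u0 u1 + D u1 u0"
proof -
  define \<kappa> where "\<kappa> = e u0 u1 + e u1 u0"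
  \<comment> \<open>Small enough for two jumps, which lose \<open>4 * L * \<eta>\<close> each, to cost at least \<open>\<kappa> / 2\<close>.\<close>
  define \<eta> where "\<eta> = min (\<kappa> / (16 * L)) ((u1 - u0) / 4)"
  have \<kappa>: "0 < \<kappa>" unfolding \<kappa>_def by (rule swap_pos)
  have \<eta>: "0 < \<eta>" "2 * \<eta> < u1 - u0" using \<kappa> L_pos u0_less_u1 by (auto simp: \<eta>_def min_def)
  have "\<eta> \<le> \<kappa> / (16 * L)" by (simp add: \<eta>_def)
  then have L\<eta>: "16 * (L * \<eta>) \<le> \<kappa>" using L_pos by (simp add: field_simps)
  obtain \<mu> where \<mu>: "0 < \<mu>" "\<And>t. t \<in> {u0..u1} \<Longrightarrow> \<not> \<bar>t - u0\<bar> < \<eta> \<Longrightarrow> \<not> \<bar>t - u1\<bar> < \<eta> \<Longrightarrow> \<mu> \<le> e t t"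
    using diag_lower_bound[OF \<eta>(1)] by blast
  have alt: "min (e p q - 4 * L * \<eta>) (\<mu> - D q p) \<le> D p q"
    if pq: "p \<in> {u0, u1}" "q \<in> {u0, u1}" "p \<noteq> q" for p q
  proof (rule le_D_I)
    show pi: "p \<in> {u0..u1}" "q \<in> {u0..u1}" using pq by auto
    fix x m n assume x: "(m::int) < n" "x \<in> X" "x m = p" "x n = q"
    have xi: "x i \<in> {u0..u1}" for i using x(2) by (auto simp: X_space_def)
    show "min (e p q - 4 * L * \<eta>) (\<mu> - D q p) \<le> action e x m n"
    proof (cases "\<forall>i. m \<le> i \<and> i \<le> n \<longrightarrow> \<bar>x i - p\<bar> < \<eta> \<or> \<bar>x i - q\<bar> < \<eta>")
      case True
      then show ?thesis using one_sided_transition[OF pq \<eta> x] by force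
    next
      case False
      then obtain i where i: "m \<le> i" "i \<le> n" "\<not> \<bar>x i - p\<bar> < \<eta>" "\<not> \<bar>x i - q\<bar> < \<eta>" by blast
      then have "\<mu> \<le> e (x i) (x i)" using \<mu>(2)[OF xi] pq by auto
      also have "\<dots> \<le> D p (x i) + D (x i) p" using D_loop[OF xi pi(1)] by (simp add: add.commute)
      also have "D (x i) p \<le> D (x i) q + D q p" by (rule D_triangle[OF xi pi(2,1)])
      finally have *: "\<mu> - D q p \<le> D p (x i) + D (x i) q" by simp
      have "i \<noteq> m" "i \<noteq> n" using i x \<eta> by auto
      then have "D p (x i) \<le> action e x m i" "D (x i) q \<le> action e x i n"
        using D_le[of m i x] D_le[of i n x] i x by auto
      moreover have "action e x m n = action e x m i + action e x i n"
        using action_split i by blast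
      ultimately show ?thesis using * by simp
    qed
  qed
  have "min (e u0 u1 - 4 * L * \<eta>) (\<mu> - D u1 u0) \<le> D u0 u1"
       "min (e u1 u0 - 4 * L * \<eta>) (\<mu> - D u0 u1) \<le> D u1 u0"
    using alt[of u0 u1] alt[of u1 u0] u0_less_u1 by auto
  then show ?thesis using \<mu>(1) \<kappa> L\<eta> by (simp add: min_def \<kappa>_def split: if_splits)
qed

end

section \<open>Semiconcave minima and series that are almost nonnegative\<close>

text \<open>
  The left difference quotients increase to their supremum, which is a slope of support.
\<close>

lemma convex_left_derivative:
  fixes C :: "real \<Rightarrow> real"
  assumes C: "convex_on UNIV C"
  obtains l where "(C has_real_derivative l) (at_left x)" "\<And>t. C x + l * (t - x) \<le> C t"
proof -
  define s where "s t = (C t - C x) / (t - x)" for t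
  define l where "l = Sup (s ` {..<x})"
  have mono: "s a \<le> s b" if "a < b" "b < x" for a b
    using convex_on_slope_le(2)[OF C, of a x b] that by (simp add: s_def)
  have ub: "s a \<le> s b" if "a < x" "x < b" for a b
  proof -
    have "(C a - C x) / (a - x) \<le> (C x - C b) / (x - b)"
      using convex_on_slope_le[OF C, of a b x] that by simp
    moreover have "(C x - C b) / (x - b) = (C b - C x) / (b - x)"
      by (metis minus_diff_eq minus_divide_divide)
    ultimately show ?thesis by (simp add: s_def)
  qed
  have bdd: "bdd_above (s ` {..<x})" by (intro bdd_aboveI2[of _ _ "s (x + 1)"] ub) auto
  have le_l: "s a \<le> l" if "a < x" for a unfolding l_def by (intro cSup_upper bdd) (use that in auto)
  have l_le: "l \<le> s b" if "x < b" for b unfolding l_def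
    by (rule cSup_least) (use ub that in \<open>auto intro!: exI[of _ "x - 1"]\<close>)
  have "(s \<longlongrightarrow> l) (at_left x)"
  proof (rule order_tendstoI)
    fix a assume "a < l"
    then obtain t where t: "t < x" "a < s t"
      unfolding l_def using less_cSup_iff[OF _ bdd] by (auto intro: lt_ex)
    have "a < s y" if "t < y" "y < x" for y using mono[OF that] t by simp
    then show "\<forall>\<^sub>F y in at_left x. a < s y" using t(1) by (auto simp: eventually_at_left_field)
  next
    fix a assume a: "l < a"
    have "s y < a" if "y < x" for y using le_l[OF that] a by simp
    then show "\<forall>\<^sub>F y in at_left x. s y < a"
      by (auto simp: eventually_at_left_field intro!: exI[of _ "x - 1"])
  qed
  then have "(C has_real_derivative l) (at_left x)"
    by (simp add: has_field_derivative_iff s_def[abs_def])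
  moreover have "C x + l * (t - x) \<le> C t" for t
    using le_l[of t] l_le[of t] by (cases t x rule: linorder_cases) (auto simp: s_def field_simps)
  ultimately show ?thesis using that by blast
qed

text \<open>
  Up to a quadratic, \<open>f + g\<close> is minus a convex function, whose left derivative is also a slope of
  support from the right. At a local minimum the left derivative of \<open>f + g\<close> is at most zero, and the
  support inequality on the right shows that it is at least zero.
\<close>

lemma semiconcave_local_min_left_derivatives:
  fixes f g :: "real \<Rightarrow> real"
  assumes f: "convex_on UNIV (\<lambda>t. \<theta> * t\<^sup>2 / 2 - f t)" and g: "convex_on UNIV (\<lambda>t. \<theta> * t\<^sup>2 / 2 - g t)"
    and "0 < \<delta>" and min: "\<And>t. \<bar>t - x\<bar> < \<delta> \<Longrightarrow> f x + g x \<le> f t + g t"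
  shows "\<exists>d2 d1. (f has_real_derivative d2) (at_left x) \<and> (g has_real_derivative d1) (at_left x) \<and> d2 + d1 = 0"
proof -
  obtain l where l: "((\<lambda>t. \<theta> * t\<^sup>2 / 2 - f t) has_real_derivative l) (at_left x)"
    "\<And>t. (\<theta> * x\<^sup>2 / 2 - f x) + l * (t - x) \<le> \<theta> * t\<^sup>2 / 2 - f t"
    using convex_left_derivative[OF f] by blast
  obtain r where r: "((\<lambda>t. \<theta> * t\<^sup>2 / 2 - g t) has_real_derivative r) (at_left x)"
    "\<And>t. (\<theta> * x\<^sup>2 / 2 - g x) + r * (t - x) \<le> \<theta> * t\<^sup>2 / 2 - g t"
    using convex_left_derivative[OF g] by blast
  have q: "((\<lambda>t. \<theta> * t\<^sup>2 / 2) has_real_derivative \<theta> * x) (at_left x)"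
    by (auto intro!: derivative_eq_intros)
  have df: "(f has_real_derivative \<theta> * x - l) (at_left x)" using DERIV_diff[OF q l(1)] by simp
  have dg: "(g has_real_derivative \<theta> * x - r) (at_left x)" using DERIV_diff[OF q r(1)] by simp
  have key: "l + r \<le> \<theta> * (t + x)" if "x < t" "t < x + \<delta>" for t
  proof -
    have "(l + r) * (t - x) \<le> \<theta> * (t + x) * (t - x)"
      using min[of t] l(2)[of t] r(2)[of t] that by (simp add: algebra_simps power2_eq_square)
    then show ?thesis using that by simp
  qed
  have "l + r \<le> \<theta> * (x + x)"
  proof (rule tendsto_lowerbound)
    show "((\<lambda>t. \<theta> * (t + x)) \<longlongrightarrow> \<theta> * (x + x)) (at_right x)" by (intro tendsto_intros)
    show "\<forall>\<^sub>F t in at_right x. l + r \<le> \<theta> * (t + x)" using key \<open>0 < \<delta>\<close>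
      by (auto simp: eventually_at_right_field intro!: exI[of _ "x + \<delta>"])
  qed simp
  moreover have "(\<theta> * x - l) + (\<theta> * x - r) \<le> 0"
  proof (rule tendsto_upperbound)
    have "((\<lambda>t. f t + g t) has_real_derivative (\<theta> * x - l) + (\<theta> * x - r)) (at_left x)"
      by (rule DERIV_add[OF df dg])
    then show "((\<lambda>t. (f t + g t - (f x + g x)) / (t - x)) \<longlongrightarrow> (\<theta> * x - l) + (\<theta> * x - r)) (at_left x)"
      by (simp add: has_field_derivative_iff)
    have "(f t + g t - (f x + g x)) / (t - x) \<le> 0" if "x - \<delta> < t" "t < x" for t
      using min[of t] that by (intro divide_nonneg_neg) auto
    then show "\<forall>\<^sub>F t in at_left x. (f t + g t - (f x + g x)) / (t - x) \<le> 0" using \<open>0 < \<delta>\<close>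
      by (auto simp: eventually_at_left_field intro!: exI[of _ "x - \<delta>"])
  qed simp
  ultimately have "(\<theta> * x - l) + (\<theta> * x - r) = 0" by (simp add: algebra_simps)
  with df dg show ?thesis by blast
qed

lemma compact_box: "compact {x :: int \<Rightarrow> real. \<forall>i. x i \<in> {lo i..hi i}}"
proof -
  have "compactin (product_topology (\<lambda>i::int. euclidean) UNIV) (PiE UNIV (\<lambda>i. {lo i..hi i :: real}))"
    by (simp add: compactin_PiE)
  moreover have "PiE UNIV (\<lambda>i. {lo i..hi i}) = {x. \<forall>i. x i \<in> {lo i..hi i}}"
    by (auto simp: PiE_def Pi_def extensional_def)
  ultimately show ?thesis by (simp add: euclidean_product_topology compactin_euclidean_iff)
qed

definition window :: "nat \<Rightarrow> int set" where "window n = {i. \<bar>i\<bar> \<le> int n}"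

lemma window_eq: "window n = {- int n..int n}"
  by (auto simp: window_def)

lemma finite_window [simp]: "finite (window n)"
  by (simp add: window_eq)

lemma window_mono: "m \<le> n \<Longrightarrow> window m \<subseteq> window n"
  by (auto simp: window_def)

text \<open>
  After adding the summable \<open>s\<close> all terms are nonnegative, so the partial sums increase: they
  converge in the extended reals, and their supremum is lower semicontinuous. The element \<open>T\<close> of
  finite value rules out that the functional is identically infinite, in which case being a minimizer
  would say nothing.
\<close>

lemma almost_nonneg_series_minimizer:
  fixes B :: "(int \<Rightarrow> real) \<Rightarrow> int \<Rightarrow> real" and s :: "int \<Rightarrow> real"
  assumes F: "compact F" and cont: "\<And>i. continuous_on F (\<lambda>x. B x i)"
    and lower: "\<And>x i. x \<in> F \<Longrightarrow> - s i \<le> B x i"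
    and s: "\<And>i. 0 \<le> s i" "\<And>n. (\<Sum>i\<in>window n. s i) \<le> S"
    and T: "T \<in> F" "\<And>n. (\<Sum>i\<in>window n. B T i) \<le> M"
  defines "P \<equiv> \<lambda>x n. ereal (\<Sum>i\<in>window n. B x i)"
  shows "\<And>x. x \<in> F \<Longrightarrow> convergent (P x)"
    and "\<exists>x\<in>F. \<forall>y\<in>F. lim (P x) \<le> lim (P y)"
    and "\<And>x. x \<in> F \<Longrightarrow> lim (P x) \<le> lim (P T) \<Longrightarrow> \<exists>r. (\<lambda>n. \<Sum>i\<in>window n. B x i) \<longlonglongrightarrow> r"
proof -
  define \<sigma> where "\<sigma> = (SUP n. \<Sum>i\<in>window n. s i)"
  have s_lim: "(\<lambda>n. \<Sum>i\<in>window n. s i) \<longlonglongrightarrow> \<sigma>" unfolding \<sigma>_def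
    by (intro LIMSEQ_incseq_SUP bdd_aboveI2[of _ _ S] s(2) monoI sum_mono2 window_mono) (use s in auto)
  define Q where "Q x n = (\<Sum>i\<in>window n. B x i + s i)" for x n
  have Q_eq: "Q x n = (\<Sum>i\<in>window n. B x i) + (\<Sum>i\<in>window n. s i)" for x n
    by (simp add: Q_def sum.distrib)
  have bs: "0 \<le> B x i + s i" if "x \<in> F" for x i using lower[OF that, of i] by simp
  have Q_inc: "incseq (Q x)" if "x \<in> F" for x unfolding Q_def
    by (intro monoI sum_mono2 window_mono finite_window bs that)
  have Q_nonneg: "0 \<le> Q x n" if "x \<in> F" for x n unfolding Q_def
    by (intro sum_nonneg bs that)
  define J where "J x = (SUP n. ereal (Q x n))" for x
  have J_lim: "(\<lambda>n. ereal (Q x n)) \<longlonglongrightarrow> J x" if "x \<in> F" for x unfolding J_def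
    using Q_inc[OF that] by (intro LIMSEQ_SUP) (auto simp: incseq_def)
  have P_lim: "P x \<longlonglongrightarrow> J x - ereal \<sigma>" if "x \<in> F" for x
  proof -
    have "(\<lambda>n. ereal (Q x n) - ereal (\<Sum>i\<in>window n. s i)) \<longlonglongrightarrow> J x - ereal \<sigma>"
      by (intro tendsto_diff_ereal_general J_lim that tendsto_ereal s_lim) simp
    then show ?thesis by (simp add: P_def Q_eq)
  qed
  then show "convergent (P x)" if "x \<in> F" for x using that by (auto simp: convergent_def)
  have limP: "lim (P x) = J x - ereal \<sigma>" if "x \<in> F" for x using P_lim[OF that] by (rule limI)
  have JT: "J T \<le> ereal (M + S)" unfolding J_def
    by (intro SUP_least) (use T(2) s(2) in \<open>simp add: Q_eq add_mono\<close>)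
  have J0: "0 \<le> J x" if "x \<in> F" for x unfolding J_def
    by (intro SUP_upper2[of 0]) (use Q_nonneg[OF that] in auto)
  have diff_mono: "J x - ereal \<sigma> \<le> J y - ereal \<sigma> \<longleftrightarrow> J x \<le> J y" for x y
    by (cases "J x"; cases "J y") auto
  show "\<exists>r. (\<lambda>n. \<Sum>i\<in>window n. B x i) \<longlonglongrightarrow> r" if x: "x \<in> F" "lim (P x) \<le> lim (P T)" for x
  proof -
    have "J x \<le> ereal (M + S)" using x JT by (simp add: limP T diff_mono)
    then obtain j where j: "J x = ereal j" using J0[OF x(1)] by (cases "J x") auto
    have "P x \<longlonglongrightarrow> ereal (j - \<sigma>)" using P_lim[OF x(1)] j by simp
    then show ?thesis unfolding P_def by (auto simp: lim_ereal)
  qed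
  show "\<exists>x\<in>F. \<forall>y\<in>F. lim (P x) \<le> lim (P y)"
  proof -
    define m where "m = (INF y\<in>F. J y)"
    have "m \<le> J T" unfolding m_def by (rule INF_lower[OF T(1)])
    moreover have "0 \<le> m" unfolding m_def by (rule INF_greatest) (rule J0)
    ultimately obtain r where r: "m = ereal r" using JT by (cases m) auto
    have "\<exists>x\<in>F. J x < m + ereal (1 / Suc j)" for j
    proof -
      have "m < m + ereal (1 / Suc j)" by (simp add: r)
      then show ?thesis unfolding m_def by (simp add: INF_less_iff)
    qed
    then obtain x where x: "\<And>j. x j \<in> F" "\<And>j. J (x j) < m + ereal (1 / Suc j)" by metis
    have "seq_compact F" using F by (rule compact_imp_seq_compact)
    then obtain l f where l: "l \<in> F" "strict_mono f" "(x \<circ> f) \<longlonglongrightarrow> l"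
      using x(1) unfolding seq_compact_def by metis
    have "Q l n \<le> r" for n
    proof (rule LIMSEQ_le)
      have "continuous_on F (\<lambda>x. Q x n)" unfolding Q_def by (intro continuous_intros cont)
      then show "(\<lambda>j. Q ((x \<circ> f) j) n) \<longlonglongrightarrow> Q l n"
        by (rule continuous_on_tendsto_compose[OF _ l(3) l(1)]) (use x in auto)
      have "(\<lambda>j. r + 1 / Suc (f j)) \<longlonglongrightarrow> r + 0"
        by (intro tendsto_intros LIMSEQ_subseq_LIMSEQ[OF LIMSEQ_inverse_real_of_nat l(2), unfolded o_def inverse_eq_divide])
      then show "(\<lambda>j. r + 1 / Suc (f j)) \<longlonglongrightarrow> r" by simp
      have "Q ((x \<circ> f) j) n \<le> r + 1 / Suc (f j)" for j
      proof -
        have "ereal (Q (x (f j)) n) \<le> J (x (f j))" unfolding J_def by (rule SUP_upper) simp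
        also have "\<dots> \<le> ereal (r + 1 / Suc (f j))" using x(2)[of "f j"] r by simp
        finally show ?thesis by simp
      qed
      then show "\<exists>N. \<forall>j\<ge>N. Q ((x \<circ> f) j) n \<le> r + 1 / Suc (f j)" by blast
    qed
    then have "J l \<le> m" unfolding J_def r by (intro SUP_least) simp
    then have "J l \<le> J y" if "y \<in> F" for y
      using INF_lower[OF that, of J] unfolding m_def by (rule order_trans)
    then show ?thesis using l(1) by (intro bexI[of _ l]) (auto simp: limP diff_mono)
  qed
qed

section \<open>From twist potentials to the excess\<close>

lemma action_two_steps:
  "action e x (- 1) 1 = e (x (- 1)) (x 0) + e (x 0) (x 1)"
  using action_first[of "-1" 1 e x] action_first[of 0 1 e x] by simp

lemma minimal_triple:
  assumes "\<And>t. h y z + h z s \<le> h y t + h t s"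
  shows "minimal_on h (- 1) 1 (\<lambda>i. if i < 0 then y else if i = 0 then z else s)"
  unfolding minimal_on_def
proof (intro allI impI)
  fix n0 n1 w
  let ?x = "\<lambda>i::int. if i < 0 then y else if i = 0 then z else s"
  assume *: "- 1 \<le> n0 \<and> n0 \<le> n1 \<and> n1 \<le> (1::int) \<and> w n0 = ?x n0 \<and> w n1 = ?x n1"
  then consider "n0 = n1" | "n1 = n0 + 1" | "n0 = - 1" "n1 = 1" by linarith
  then show "action h ?x n0 n1 \<le> action h w n0 n1"
  proof cases
    case 2
    then show ?thesis using * by (simp only: action_step)
  next
    case 3
    then show ?thesis using * assms[of "w 0"] by (simp add: action_two_steps)
  qed simp
qed

context twist_potential
begin

lemma submodular: "a \<le> a' \<Longrightarrow> b \<le> b' \<Longrightarrow> h a b + h a' b' \<le> h a b' + h a' b"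
  using h3[of a a' b b'] by (cases "a = a'"; cases "b = b'") auto

text \<open>
  Moving to \<open>y\<close>, resting there for a long time and coming back would otherwise be cheaper than
  resting at \<open>u\<close>.
\<close>

lemma minimal_constant_diagonal:
  assumes "minimal h (\<lambda>_. u)"
  shows "h u u \<le> h y y"
proof (rule ccontr)
  assume "\<not> h u u \<le> h y y"
  then have d: "0 < h u u - h y y" by simp
  define C where "C = h u y + h y u - 2 * h y y"
  obtain n :: nat where "C / (h u u - h y y) < real n" using reals_Archimedean2 by blast
  then have n: "C < real n * (h u u - h y y)" using d by (simp add: field_simps)
  define N where "N = int n + 2"
  define x where "x = (\<lambda>i::int. if i = 0 \<or> i = N then u else y)"
  have "minimal_on h 0 N (\<lambda>_. u)" using assms by (simp add: minimal_def N_def)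
  from this[unfolded minimal_on_def, rule_format, of 0 N x]
  have "action h (\<lambda>_. u) 0 N \<le> action h x 0 N" by (simp add: x_def N_def)
  moreover have "action h (\<lambda>_. u) 0 N = (n + 2) * h u u" by (simp add: action_const N_def)
  moreover have "action h x 0 N = h u y + n * h y y + h y u"
  proof -
    have "action h x 1 (N - 1) = action h (\<lambda>_. y) 1 (N - 1)"
      by (rule action_cong) (auto simp: x_def)
    then have "action h x 1 (N - 1) = n * h y y" by (simp add: action_const N_def)
    then show ?thesis
      using action_first[of 0 N h x] action_last[of 1 N h x] by (simp add: x_def N_def)
  qed
  moreover have "0 \<le> real n * (h u u - h y y)" using d by simp
  ultimately show False using n d by (simp add: C_def algebra_simps)
qed

lemma min_level_eq: "minimal h (\<lambda>_. u) \<Longrightarrow> min_level h = h u u"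
  unfolding min_level_def
  by (rule cInf_eq_minimum) (use minimal_constant_diagonal in auto)

lemma separately_lipschitz:
  obtains L where "0 < L" "\<And>a a' b. \<bar>h a b - h a' b\<bar> \<le> L * \<bar>a - a'\<bar>"
    "\<And>a b b'. \<bar>h a b - h a b'\<bar> \<le> L * \<bar>b - b'\<bar>"
proof -
  obtain K where K: "K-lipschitz_on UNIV (\<lambda>(a, b). h a b)" using lipschitz by blast
  have K0: "0 \<le> K" by (rule lipschitz_on_nonneg[OF K])
  have "\<bar>h a b - h a' b\<bar> \<le> K * \<bar>a - a'\<bar>" for a a' b
    using lipschitz_onD[OF K, of "(a, b)" "(a', b)"] by (simp add: dist_real_def dist_Pair_Pair)
  moreover have "\<bar>h a b - h a b'\<bar> \<le> K * \<bar>b - b'\<bar>" for a b b'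
    using lipschitz_onD[OF K, of "(a, b)" "(a, b')"] by (simp add: dist_real_def dist_Pair_Pair)
  moreover have "K * \<bar>t\<bar> \<le> (K + 1) * \<bar>t\<bar>" for t :: real by (intro mult_right_mono) auto
  ultimately show ?thesis using that[of "K + 1"] K0 by (meson add_nonneg_pos order_trans zero_less_one)
qed

text \<open>
  A zero of the diagonal excess strictly between the rest points would, by the rearrangement
  inequality, give a minimal constant configuration there, which neighboring rest points exclude.
\<close>

lemma two_well_excess:
  assumes "neighboring_pair h u0 u1"
  obtains L where "two_well (\<lambda>a b. h a b - min_level h) u0 u1 L"
proof -
  obtain L where L: "0 < L" "\<And>a a' b. \<bar>h a b - h a' b\<bar> \<le> L * \<bar>a - a'\<bar>"
    "\<And>a b b'. \<bar>h a b - h a b'\<bar> \<le> L * \<bar>b - b'\<bar>"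
    by (rule separately_lipschitz) blast
  have nb: "u0 < u1" "minimal h (\<lambda>_. u0)" "minimal h (\<lambda>_. u1)"
    "\<And>u. u0 < u \<Longrightarrow> u < u1 \<Longrightarrow> \<not> minimal h (\<lambda>_. u)"
    using assms by (auto simp: neighboring_pair_def)
  define c where "c = min_level h"
  have c: "h u0 u0 = c" "h u1 u1 = c" using min_level_eq[OF nb(2)] min_level_eq[OF nb(3)] by (simp_all add: c_def)
  have ge: "c \<le> h y y" for y using minimal_constant_diagonal[OF nb(2)] c by simp
  have "two_well (\<lambda>a b. h a b - c) u0 u1 L"
  proof
    show "0 < h u0 u1 - c + (h u1 u0 - c)" using h3[OF nb(1,1)] c by simp
    show "h a b - c + (h a' b' - c) \<le> h a b' - c + (h a' b - c)" if "a \<le> a'" "b \<le> b'" for a a' b b'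
      using submodular[OF that] by simp
    show "0 < h a a - c" if a: "u0 < a" "a < u1" for a
    proof (rule ccontr)
      assume "\<not> 0 < h a a - c"
      with ge have ha: "h a a = c" by (simp add: antisym)
      have "action h (\<lambda>_. a) n0 n1 \<le> action h y n0 n1" if "n0 \<le> n1" "y n0 = a" "y n1 = a" for n0 n1 y
      proof -
        have "of_int (n1 - n0 + 1) * c = (\<Sum>i\<in>{n0..n1}. c)" using that by simp
        also have "\<dots> \<le> (\<Sum>i\<in>{n0..n1}. h (y i) (y i))" by (intro sum_mono ge)
        also have "\<dots> \<le> action h y n0 n1 + h (y n1) (y n0)"
          by (rule cyclic_sum_ge_diagonal[OF submodular that(1)])
        finally show ?thesis using that ha by (simp add: action_const algebra_simps)
      qed
      then have "minimal h (\<lambda>_. a)" by (auto simp: minimal_def minimal_on_def)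
      with nb(4)[OF a] show False by simp
    qed
    show "y = y'" if y: "\<And>t. h y z - c + (h z s - c) \<le> h y t - c + (h t s - c)"
      "\<And>t. h y' z - c + (h z s - c) \<le> h y' t - c + (h t s - c)" for y y' z s
    proof (rule ccontr)
      assume "y \<noteq> y'"
      then show False using y
          h4[OF minimal_triple[of h y z s] minimal_triple[of h y' z s]] by simp
    qed
    show "s = s'" if y: "\<And>t. h y z - c + (h z s - c) \<le> h y t - c + (h t s - c)"
      "\<And>t. h y z - c + (h z s' - c) \<le> h y t - c + (h t s' - c)" for y z s s'
    proof (rule ccontr)
      assume "s \<noteq> s'"
      then show False using y
          h4[OF minimal_triple[of h y z s] minimal_triple[of h y z s']] by simp
    qed
  qed (use nb L c ge in auto)
  then show ?thesis using that by (simp add: c_def)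
qed

end

lemma bounded_rotation_number_zero:
  fixes x :: "int \<Rightarrow> real"
  assumes "(x \<longlongrightarrow> a) at_bot" "(x \<longlongrightarrow> b) at_top"
  shows "has_rotation_number x 0"
proof -
  have "filterlim (of_int :: int \<Rightarrow> real) at_infinity at_top"
    by (intro filterlim_at_top_imp_at_infinity filterlim_real_of_int_at_top)
  moreover have "filterlim (of_int :: int \<Rightarrow> real) at_bot at_bot"
    unfolding filterlim_at_bot eventually_at_bot_linorder
  proof
    fix Z :: real
    show "\<exists>N. \<forall>n\<le>N. real_of_int n \<le> Z" by (intro exI[of _ "\<lfloor>Z\<rfloor>"]) linarith
  qed
  then have "filterlim (of_int :: int \<Rightarrow> real) at_infinity at_bot"
    by (rule filterlim_at_bot_imp_at_infinity)
  ultimately show ?thesis unfolding has_rotation_number_def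
    using assms tendsto_divide_0 by blast
qed

lemma gap_imp_defect_pos:
  assumes tw: "two_well (\<lambda>a b. h a b - c) u0 u1 L"
    and pq: "p \<in> {u0, u1}" "q \<in> {u0, u1}" "p \<noteq> q"
    and y: "y \<in> {u0<..<u1}" "y \<notin> heteroclinic_values h p q"
  shows "0 < two_well.defect (\<lambda>a b. h a b - c) u0 u1 p q y"
proof (rule ccontr)
  interpret two_well "\<lambda>a b. h a b - c" u0 u1 L by (rule tw)
  assume "\<not> 0 < defect p q y"
  then have "y \<in> tight p q" using defect_nonneg[of p q y] pq y by (auto simp: tight_def)
  then obtain x where x: "x 0 = y" "(x \<longlongrightarrow> p) at_bot" "(x \<longlongrightarrow> q) at_top"
    "\<And>m n w. m \<le> n \<Longrightarrow> w m = x m \<Longrightarrow> w n = x n \<Longrightarrow>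
      action (\<lambda>a b. h a b - c) x m n \<le> action (\<lambda>a b. h a b - c) w m n"
    using tight_heteroclinic[OF pq, of y] y pq by auto
  have "action h x m n \<le> action h w m n" if "m \<le> n" "w m = x m" "w n = x n" for m n w
    using x(4)[OF that] by (simp add: action_minus_const[OF that(1)])
  then have "minimal h x" by (simp add: minimal_def minimal_on_def)
  then have "y \<in> heteroclinic_values h p q"
    using x bounded_rotation_number_zero[OF x(2,3)] by (auto simp: heteroclinic_values_def)
  with y show False by simp
qed

section \<open>Local minimizers that follow an itinerary\<close>

lemma action_telescope:
  fixes k :: "int \<Rightarrow> int"
  assumes "\<And>i. k i \<le> k (i + 1)" "a \<le> b"
  shows "k a \<le> k b \<and> (\<Sum>i\<in>{a..<b}. action e x (k i) (k (i + 1))) = action e x (k a) (k b)"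
  using assms(2)
proof (induction b rule: int_ge_induct)
  case (step i)
  have "{a..<i + 1} = insert i {a..<i}" using step.hyps by auto
  then show ?case using step assms(1)[of i] action_split[of "k a" "k i" "k (i + 1)" e x] by simp
qed simp

context two_well
begin

lemma action_change_ends:
  assumes "m < n" "\<And>j. m < j \<Longrightarrow> j < n \<Longrightarrow> y j = t j"
  shows "action e y m n \<le> action e t m n + L * (\<bar>y m - t m\<bar> + \<bar>y n - t n\<bar>)"
proof (cases "n = m + 1")
  case True
  then show ?thesis using abs_e_diff[of "y m" "y n" "t m" "t n"] by (simp only: action_step)
next
  case False
  have "action e z m n = e (z m) (z (m + 1)) + action e z (m + 1) (n - 1) + e (z (n - 1)) (z n)" for z
    using action_first[of m n e z] action_last[of "m + 1" n e z] assms(1) False by simp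
  moreover have "action e y (m + 1) (n - 1) = action e t (m + 1) (n - 1)"
    by (rule action_cong) (use assms in simp)
  moreover have "y (m + 1) = t (m + 1)" "y (n - 1) = t (n - 1)" using assms False by auto
  ultimately show ?thesis
    using lip1[of "y m" "t (m + 1)" "t m"] lip2[of "t (n - 1)" "y n" "t n"]
    by (simp add: algebra_simps abs_le_iff)
qed

text \<open>
  Moving the end points of a passage changes its cost by at most \<open>L\<close> times the displacement.
\<close>

lemma D_near:
  assumes "a \<in> {u0..u1}" "b \<in> {u0..u1}" "a' \<in> {u0..u1}" "b' \<in> {u0..u1}"
  shows "D a b - L * (\<bar>a - a'\<bar> + \<bar>b - b'\<bar>) \<le> D a' b'"
  using D_lip1[OF assms(3,1,2)] D_lip2[OF assms(3,4,2)] by (simp add: algebra_simps)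

end

text \<open>
  The itinerary prescribes the rest point \<open>v i\<close> at time \<open>k i\<close>, up to the error \<open>\<rho> i\<close>.
\<close>

locale itinerary = two_well e u0 u1 L
  for e :: "real \<Rightarrow> real \<Rightarrow> real" and u0 u1 L :: real +
  fixes v :: "int \<Rightarrow> real" and k :: "int \<Rightarrow> int" and \<rho> :: "int \<Rightarrow> real"
  assumes v_end: "v i \<in> {u0, u1}"
    and k_less: "k i < k (i + 1)"
    and \<rho>_pos: "0 < \<rho> i" and \<rho>_less: "\<rho> i < (u1 - u0) / 2"
begin

definition admissible where
  "admissible = {x \<in> X. \<forall>i. \<bar>x (k i) - v i\<bar> \<le> \<rho> i}"

text \<open>
  Minimality against finite modifications is the only property of minimizers of the
  renormalized functional that matters for stationarity.
\<close>

definition local_minimizer where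
  "local_minimizer x \<longleftrightarrow> x \<in> admissible \<and>
     (\<forall>y\<in>admissible. \<forall>m n. m \<le> n \<longrightarrow> (\<forall>j. j \<le> m \<or> n \<le> j \<longrightarrow> y j = x j) \<longrightarrow>
        action e x m n \<le> action e y m n)"

lemma local_minimizerD:
  "local_minimizer x \<Longrightarrow> y \<in> admissible \<Longrightarrow> m \<le> n \<Longrightarrow> (\<And>j. j \<le> m \<or> n \<le> j \<Longrightarrow> y j = x j) \<Longrightarrow>
    action e x m n \<le> action e y m n"
  by (simp add: local_minimizer_def)

lemma admissible_in: "x \<in> admissible \<Longrightarrow> x i \<in> {u0..u1}"
  by (auto simp: admissible_def X_space_def)

lemma admissible_near: "x \<in> admissible \<Longrightarrow> \<bar>x (k i) - v i\<bar> \<le> \<rho> i"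
  by (auto simp: admissible_def)

lemma v_in: "v i \<in> {u0..u1}"
  using v_end[of i] u0_less_u1 by auto

lemma k_mono: "i \<le> j \<Longrightarrow> k i \<le> k j"
  using action_telescope[of k i j] k_less by (simp add: less_imp_le)

lemma k_between: "k i < k j \<Longrightarrow> \<not> k j < k (i + 1)"
  using k_mono[of j i] k_mono[of "i + 1" j] by linarith

lemma replace_admissible:
  assumes "x \<in> admissible" "z \<in> X" "\<And>i. m < k i \<Longrightarrow> k i < n \<Longrightarrow> z (k i) = v i"
  shows "(\<lambda>j. if m < j \<and> j < n then z j else x j) \<in> admissible"
  using assms \<rho>_pos by (auto simp: admissible_def X_space_def less_imp_le)

text \<open>
  Resting at \<open>v i\<close> during the block is a competitor, so the block has small excess. If the
  configuration were close to the other rest point at some time, the block would cost a round trip; if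
  it stayed away from both rest points, it would cost at least \<open>\<mu>\<close> per step, which is too much in a
  long block.
\<close>

lemma visits_rest_point:
  assumes x: "local_minimizer x" and same: "v i = v (i + 1)"
    and \<mu>: "\<And>t. t \<in> {u0..u1} \<Longrightarrow> \<not> \<bar>t - u0\<bar> < \<zeta> \<Longrightarrow> \<not> \<bar>t - u1\<bar> < \<zeta> \<Longrightarrow> \<mu> \<le> e t t"
    and long: "2 * L * (u1 - u0) < of_int (k (i + 1) - k i) * \<mu>"
    and small: "2 * L * (\<rho> i + \<rho> (i + 1) + \<zeta>) < D u0 u1 + D u1 u0" "\<zeta> \<le> \<rho> i"
  obtains q where "k i \<le> q" "q < k (i + 1)" "\<bar>x q - v i\<bar> < \<zeta>"
proof (rule ccontr)
  assume "\<not> thesis"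
  with that have far: "\<And>q. k i \<le> q \<Longrightarrow> q < k (i + 1) \<Longrightarrow> \<not> \<bar>x q - v i\<bar> < \<zeta>" by blast
  have xa: "x \<in> admissible" using x by (simp add: local_minimizer_def)
  note xi = admissible_in[OF xa]
  have xX: "x \<in> X" using xa by (simp add: admissible_def)
  let ?y = "\<lambda>j. if k i < j \<and> j < k (i + 1) then v i else x j"
  have ya: "?y \<in> admissible"
    by (rule replace_admissible[OF xa]) (use v_in k_between in \<open>auto simp: X_space_def\<close>)
  have "action e x (k i) (k (i + 1)) \<le> action e ?y (k i) (k (i + 1))"
    by (rule local_minimizerD[OF x ya]) (use k_less[of i] in auto)
  also have "\<dots> \<le> action e (\<lambda>_. v i) (k i) (k (i + 1))
      + L * (\<bar>?y (k i) - v i\<bar> + \<bar>?y (k (i + 1)) - v i\<bar>)"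
    by (rule action_change_ends) (use k_less in auto)
  also have "action e (\<lambda>_. v i) (k i) (k (i + 1)) = 0"
    using k_less[of i] diag_end[OF v_end] by (simp add: action_const less_imp_le)
  also have "L * (\<bar>?y (k i) - v i\<bar> + \<bar>?y (k (i + 1)) - v i\<bar>) \<le> L * (\<rho> i + \<rho> (i + 1))"
    using admissible_near[OF xa, of i] admissible_near[OF xa, of "i + 1"] same L_pos
    by (intro mult_left_mono add_mono) auto
  finally have upper: "action e x (k i) (k (i + 1)) \<le> L * (\<rho> i + \<rho> (i + 1))" by simp
  show False
  proof (cases "\<exists>q. k i \<le> q \<and> q < k (i + 1) \<and> (\<bar>x q - u0\<bar> < \<zeta> \<or> \<bar>x q - u1\<bar> < \<zeta>)")
    case True
    then obtain q w where q: "k i \<le> q" "q < k (i + 1)" "\<bar>x q - w\<bar> < \<zeta>" "w \<in> {u0, u1}" by blast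
    then have w: "w \<noteq> v i" using far by blast
    have "q \<noteq> k i"
    proof
      assume "q = k i"
      then show False using q w v_end[of i] admissible_near[OF xa, of i] \<rho>_less[of i] small(2)
        by (auto simp: abs_less_iff abs_le_iff)
    qed
    then have "action e x (k i) (k (i + 1)) \<ge> D (x (k i)) (x q) + D (x q) (x (k (i + 1)))"
      using q D_le[of "k i" q x] D_le[of q "k (i + 1)" x] xX action_split[of "k i" q "k (i + 1)" e x] by simp
    moreover have "D (v i) w - L * (\<bar>v i - x (k i)\<bar> + \<bar>w - x q\<bar>) \<le> D (x (k i)) (x q)"
      by (rule D_near) (use v_in q xi in auto)
    moreover have "D w (v i) - L * (\<bar>w - x q\<bar> + \<bar>v i - x (k (i + 1))\<bar>) \<le> D (x q) (x (k (i + 1)))"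
      by (rule D_near) (use v_in q xi in auto)
    moreover have "L * \<bar>v i - x (k i)\<bar> \<le> L * \<rho> i" "L * \<bar>v i - x (k (i + 1))\<bar> \<le> L * \<rho> (i + 1)"
      "L * \<bar>w - x q\<bar> \<le> L * \<zeta>"
      using admissible_near[OF xa, of i] admissible_near[OF xa, of "i + 1"] same L_pos q
      by (auto simp: abs_minus_commute)
    moreover have "D (v i) w + D w (v i) = D u0 u1 + D u1 u0" using w q(4) v_end[of i] by auto
    ultimately show False using upper small by (simp add: algebra_simps)
  next
    case False
    have "of_int (k (i + 1) - k i) * \<mu> = (\<Sum>j\<in>{k i..<k (i + 1)}. \<mu>)" using k_less[of i] by simp
    also have "\<dots> \<le> (\<Sum>j\<in>{k i..<k (i + 1)}. e (x j) (x j))"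
      by (intro sum_mono \<mu> xi) (use False in auto)
    also have "\<dots> \<le> L * (\<rho> i + \<rho> (i + 1)) + L * \<bar>x (k (i + 1)) - x (k i)\<bar>"
      using action_ge_diagonal[of "k i" "k (i + 1)" x] k_less[of i] upper by simp
    also have "\<dots> \<le> L * (u1 - u0) + L * (u1 - u0)"
      using \<rho>_less[of i] \<rho>_less[of "i + 1"] L_pos dist_le[OF xi xi] by (intro add_mono mult_left_mono) auto
    finally show False using long by simp
  qed
qed

end

text \<open>
  Here \<open>\<eta> i\<close> is the tolerance that the analysis of the \<open>i\<close>-th constraint can afford: it is small
  compared with the defect of the boundary point of that constraint. The block from \<open>k i\<close> to
  \<open>k (i + 1)\<close> is used for the constraints \<open>i - 1\<close> to \<open>i + 2\<close>, hence the four bounds on \<open>\<zeta> i\<close>; it is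
  so long that a minimizer that should rest during this block comes \<open>\<zeta> i\<close>-close to the rest point. The
  configuration \<open>T\<close> follows the itinerary exactly at almost optimal cost. It serves as competitor
  and as admissible configuration of finite renormalized action.
\<close>

locale rigid_itinerary = itinerary e u0 u1 L v k \<rho>
  for e :: "real \<Rightarrow> real \<Rightarrow> real" and u0 u1 L :: real
    and v :: "int \<Rightarrow> real" and k :: "int \<Rightarrow> int" and \<rho> :: "int \<Rightarrow> real" +
  fixes \<eta> \<zeta> \<mu> :: "int \<Rightarrow> real" and T :: "int \<Rightarrow> real"
  assumes no_isolated: "v (i - 1) = v i \<or> v i = v (i + 1)"
    and \<rho>_small: "12 * (L * \<rho> i) < D u0 u1 + D u1 u0"
    and \<eta>: "0 < \<eta> i" "\<eta> i < \<rho> i"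
    and inner_defect: "(4 * L + 2) * \<eta> i <
       defect (v (i - 1)) (v (i + 1)) (if v i = u0 then u0 + \<rho> i else u1 - \<rho> i)"
    and \<zeta>: "\<zeta> i \<le> \<eta> (i - 1)" "\<zeta> i \<le> \<eta> i" "\<zeta> i \<le> \<eta> (i + 1)" "\<zeta> i \<le> \<eta> (i + 2)"
    and \<mu>: "\<And>i t. t \<in> {u0..u1} \<Longrightarrow> \<not> \<bar>t - u0\<bar> < \<zeta> i \<Longrightarrow> \<not> \<bar>t - u1\<bar> < \<zeta> i \<Longrightarrow> \<mu> i \<le> e t t"
    and long: "2 * L * (u1 - u0) < of_int (k (i + 1) - k i) * \<mu> i"
    and T_X: "T \<in> X" and T_k: "T (k i) = v i"
    and T_action: "action e T (k i) (k (i + 1)) \<le> D (v i) (v (i + 1)) + min (\<eta> i) (\<eta> (i + 1))"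
    and T_const: "v i = v (i + 1) \<Longrightarrow> k i \<le> j \<Longrightarrow> j \<le> k (i + 1) \<Longrightarrow> T j = v i"
begin

lemma T_admissible: "T \<in> admissible"
  using T_X T_k \<rho>_pos by (simp add: admissible_def less_imp_le)

lemma T_rest:
  assumes "v i = v (i + 1)" "k i \<le> m" "m \<le> n" "n \<le> k (i + 1)"
  shows "action e T m n = 0"
proof -
  have "action e T m n = action e (\<lambda>_. v i) m n" by (rule action_cong) (use assms T_const in auto)
  then show ?thesis using assms(3) diag_end[OF v_end] by (simp add: action_const)
qed

lemma rest_visit:
  assumes "local_minimizer x" "v i = v (i + 1)"
  shows "\<exists>q. k i \<le> q \<and> q < k (i + 1) \<and> \<bar>x q - v i\<bar> < \<zeta> i"
proof -
  have "L * \<zeta> i \<le> L * \<rho> i" using \<zeta>(2)[of i] \<eta>(2)[of i] L_pos by simp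
  moreover have "0 < L * \<rho> i" "0 < L * \<rho> (i + 1)" using L_pos \<rho>_pos by simp_all
  ultimately have small: "2 * L * (\<rho> i + \<rho> (i + 1) + \<zeta> i) < D u0 u1 + D u1 u0"
    using \<rho>_small[of i] \<rho>_small[of "i + 1"] by (simp add: algebra_simps)
  have "\<zeta> i \<le> \<rho> i" using \<zeta>(2)[of i] \<eta>(2)[of i] by simp
  from visits_rest_point[OF assms \<mu> long small this] show ?thesis by blast
qed

text \<open>
  Suppose the constraint at \<open>k i\<close> is active. There are times \<open>p < k i < q\<close> at which \<open>x\<close> is
  \<open>\<eta> i\<close>-close to the rest points \<open>a = v (i - 1)\<close> and \<open>b = v (i + 1)\<close>: a block of rest adjacent to
  \<open>k i\<close> provides such a time, and if the adjacent block is a transition, the block behind it does,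
  because there are no isolated symbols. Between \<open>p\<close> and \<open>q\<close> the configuration \<open>x\<close> passes through a
  point of large defect, while \<open>T\<close> makes the passage at almost the optimal cost \<open>D a b\<close>.
\<close>

lemma constraint_strict:
  assumes x: "local_minimizer x"
  shows "\<bar>x (k i) - v i\<bar> < \<rho> i"
proof (rule ccontr)
  assume "\<not> \<bar>x (k i) - v i\<bar> < \<rho> i"
  moreover have xa: "x \<in> admissible" using x by (simp add: local_minimizer_def)
  ultimately have eq: "\<bar>x (k i) - v i\<bar> = \<rho> i" using admissible_near[OF xa, of i] by simp
  note xi = admissible_in[OF xa]
  have xX: "x \<in> X" using xa by (simp add: admissible_def)
  define a b y where "a = v (i - 1)" and "b = v (i + 1)" and "y = x (k i)"
  have y: "y = (if v i = u0 then u0 + \<rho> i else u1 - \<rho> i)"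
  proof (cases "v i = u0")
    case True
    then show ?thesis using eq xi[of "k i"] by (simp add: y_def)
  next
    case False
    then have "v i = u1" using v_end[of i] by simp
    then show ?thesis using eq xi[of "k i"] False by (simp add: y_def)
  qed
  have ab: "a \<in> {u0..u1}" "b \<in> {u0..u1}" "y \<in> {u0..u1}" using v_in xi by (auto simp: a_def b_def y_def)
  have Dv: "D (v j) (v j) = 0" for j using D_self[OF v_in] diag_end[OF v_end] by simp
  obtain p where p: "p < k i" "\<bar>x p - a\<bar> < \<eta> i" "T p = a" "action e T p (k i) \<le> D a (v i) + \<eta> i"
  proof (cases "v (i - 1) = v i")
    case True
    then obtain p where p: "k (i - 1) \<le> p" "p < k i" "\<bar>x p - v (i - 1)\<bar> < \<zeta> (i - 1)"
      using rest_visit[OF x, of "i - 1"] True by auto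
    show thesis
    proof (rule that[of p])
      show "\<bar>x p - a\<bar> < \<eta> i" using p(3) \<zeta>(3)[of "i - 1"] by (simp add: a_def)
      show "T p = a" using T_const[of "i - 1" p] p True by (simp add: a_def)
      have "action e T p (k i) = 0" using T_rest[of "i - 1" p "k i"] p True by simp
      moreover have "D a (v i) = 0" using Dv[of i] True by (simp add: a_def)
      ultimately show "action e T p (k i) \<le> D a (v i) + \<eta> i" using \<eta>(1)[of i] by simp
    qed (rule p(2))
  next
    case False
    then have same: "v (i - 2) = v (i - 1)" using no_isolated[of "i - 1"] by simp
    then obtain p where p: "k (i - 2) \<le> p" "p < k (i - 1)" "\<bar>x p - v (i - 2)\<bar> < \<zeta> (i - 2)"
      using rest_visit[OF x, of "i - 2"] same by auto
    have ki: "k (i - 1) < k i" using k_less[of "i - 1"] by simp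
    have "action e T p (k i) = action e T p (k (i - 1)) + action e T (k (i - 1)) (k i)"
      using p ki by (intro action_split) auto
    moreover have "action e T p (k (i - 1)) = 0" using T_rest[of "i - 2" p "k (i - 1)"] p same by simp
    ultimately have act: "action e T p (k i) = action e T (k (i - 1)) (k i)" by simp
    show thesis
    proof (rule that[of p])
      show "p < k i" using p(2) ki by simp
      show "\<bar>x p - a\<bar> < \<eta> i" using p(3) \<zeta>(4)[of "i - 2"] same by (simp add: a_def)
      show "T p = a" using T_const[of "i - 2" p] p same by (simp add: a_def)
      show "action e T p (k i) \<le> D a (v i) + \<eta> i"
        using T_action[of "i - 1"] act by (simp add: a_def)
    qed
  qed
  obtain q where q: "k i < q" "\<bar>x q - b\<bar> < \<eta> i" "T q = b" "action e T (k i) q \<le> D (v i) b + \<eta> i"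
  proof (cases "v i = v (i + 1)")
    case True
    then obtain q where q: "k i \<le> q" "q < k (i + 1)" "\<bar>x q - v i\<bar> < \<zeta> i"
      using rest_visit[OF x, of i] True by auto
    have "q \<noteq> k i" using q(3) eq \<zeta>(2)[of i] \<eta>(2)[of i] by auto
    show thesis
    proof (rule that[of q])
      show "k i < q" using q(1) \<open>q \<noteq> k i\<close> by simp
      show "\<bar>x q - b\<bar> < \<eta> i" using q(3) \<zeta>(2)[of i] True by (simp add: b_def)
      show "T q = b" using T_const[of i q] q True by (simp add: b_def)
      have "action e T (k i) q = 0" using T_rest[of i "k i" q] q True by simp
      moreover have "D (v i) b = 0" using Dv[of i] True by (simp add: b_def)
      ultimately show "action e T (k i) q \<le> D (v i) b + \<eta> i" using \<eta>(1)[of i] by simp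
    qed
  next
    case False
    have two: "i + 1 + 1 = i + 2" by simp
    have same: "v (i + 1) = v (i + 2)" using False no_isolated[of "i + 1"] two by simp
    then obtain q where q: "k (i + 1) \<le> q" "q < k (i + 2)" "\<bar>x q - v (i + 1)\<bar> < \<zeta> (i + 1)"
      using rest_visit[OF x, of "i + 1"] two same by auto
    have ki: "k i < k (i + 1)" by (rule k_less)
    have "action e T (k i) q = action e T (k i) (k (i + 1)) + action e T (k (i + 1)) q"
      using q ki by (intro action_split) auto
    moreover have "action e T (k (i + 1)) q = 0"
      using T_rest[of "i + 1" "k (i + 1)" q] q same two by simp
    ultimately have act: "action e T (k i) q = action e T (k i) (k (i + 1))" by simp
    show thesis
    proof (rule that[of q])
      show "k i < q" using q(1) ki by simp
      show "\<bar>x q - b\<bar> < \<eta> i" using q(3) \<zeta>(1)[of "i + 1"] by (simp add: b_def)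
      show "T q = b" using T_const[of "i + 1" q] q same two by (simp add: b_def)
      show "action e T (k i) q \<le> D (v i) b + \<eta> i"
        using T_action[of i] act by (simp add: b_def)
    qed
  qed
  let ?z = "\<lambda>j. if p < j \<and> j < q then T j else x j"
  have za: "?z \<in> admissible" by (rule replace_admissible[OF xa T_X]) (rule T_k)
  have "action e x p q \<le> action e ?z p q"
    by (rule local_minimizerD[OF x za]) (use p(1) q(1) in auto)
  also have "\<dots> \<le> action e T p q + L * (\<bar>?z p - T p\<bar> + \<bar>?z q - T q\<bar>)"
    by (rule action_change_ends) (use p(1) q(1) in auto)
  finally have "action e x p q \<le> action e T p q + L * (\<bar>x p - a\<bar> + \<bar>x q - b\<bar>)"
    by (simp add: p(3) q(3))
  moreover have "L * (\<bar>x p - a\<bar> + \<bar>x q - b\<bar>) \<le> L * (2 * \<eta> i)"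
    using p(2) q(2) L_pos by simp
  ultimately have up: "action e x p q \<le> action e T p q + L * (2 * \<eta> i)" by simp
  have "action e T p q = action e T p (k i) + action e T (k i) q"
    using p q by (intro action_split) auto
  \<comment> \<open>The rest point \<open>v i\<close> equals \<open>a\<close> or \<open>b\<close>, so being forced through it is free.\<close>
  moreover have "D a (v i) + D (v i) b = D a b"
    using no_isolated[of i] Dv by (auto simp: a_def b_def)
  ultimately have T: "action e T p q \<le> D a b + 2 * \<eta> i" using p q by simp
  have "action e x p q = action e x p (k i) + action e x (k i) q"
    using p q by (intro action_split) auto
  then have "D (x p) y + D y (x q) \<le> action e x p q"
    using D_le[OF p(1) xX] D_le[OF q(1) xX] by (simp add: y_def)
  moreover have "D a y - L * (\<bar>a - x p\<bar> + \<bar>y - y\<bar>) \<le> D (x p) y" by (rule D_near[OF ab(1,3) xi ab(3)])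
  moreover have "D y b - L * (\<bar>y - y\<bar> + \<bar>b - x q\<bar>) \<le> D y (x q)" by (rule D_near[OF ab(3,2) ab(3) xi])
  moreover have "L * \<bar>a - x p\<bar> \<le> L * \<eta> i" "L * \<bar>b - x q\<bar> \<le> L * \<eta> i"
    using p(2) q(2) L_pos by (simp_all add: abs_minus_commute)
  ultimately have "defect a b y \<le> (4 * L + 2) * \<eta> i" using up T
    by (simp add: defect_def algebra_simps)
  then show False using inner_defect[of i] unfolding y a_def b_def by linarith
qed

text \<open>
  Near \<open>x j\<close> all values in \<open>[u0, u1]\<close> are admissible since the constraints are strict, and clamping
  takes care of the values outside \<open>[u0, u1]\<close>.
\<close>

lemma one_site_minimal:
  assumes x: "local_minimizer x"
  obtains \<delta> where "0 < \<delta>" "\<And>t. \<bar>t - x j\<bar> < \<delta> \<Longrightarrow>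
    e (x (j - 1)) (x j) + e (x j) (x (j + 1)) \<le> e (x (j - 1)) t + e t (x (j + 1))"
proof -
  have xa: "x \<in> admissible" using x by (simp add: local_minimizer_def)
  note xi = admissible_in[OF xa]
  obtain \<delta> where \<delta>: "0 < \<delta>" "\<And>i. k i = j \<Longrightarrow> \<bar>x j - v i\<bar> + \<delta> \<le> \<rho> i"
  proof (cases "\<exists>i. k i = j")
    case True
    then obtain i where i: "k i = j" by blast
    have inj: "i' = i" if "k i' = j" for i'
      using that i k_mono[of "i + 1" i'] k_mono[of "i' + 1" i] k_less[of i] k_less[of i'] by linarith
    show thesis
    proof (rule that[of "\<rho> i - \<bar>x j - v i\<bar>"])
      show "0 < \<rho> i - \<bar>x j - v i\<bar>" using constraint_strict[OF x, of i] i by simp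
      show "\<bar>x j - v i'\<bar> + (\<rho> i - \<bar>x j - v i\<bar>) \<le> \<rho> i'" if "k i' = j" for i'
        using inj[OF that] by simp
    qed
  qed (use that[of 1] in auto)
  have "e (x (j - 1)) (x j) + e (x j) (x (j + 1)) \<le> e (x (j - 1)) t + e t (x (j + 1))"
    if t: "\<bar>t - x j\<bar> < \<delta>" for t
  proof -
    define t' where "t' = min u1 (max u0 t)"
    have t': "t' \<in> {u0..u1}" unfolding t'_def by (rule clamp_in)
    have close: "\<bar>t' - w\<bar> \<le> \<bar>t - w\<bar>" if "w \<in> {u0..u1}" for w
      using that by (auto simp: t'_def min_def max_def)
    let ?y = "x(j := t')"
    have "\<bar>t' - v i\<bar> \<le> \<rho> i" if "k i = j" for i
      using \<delta>(2)[OF that] t close[OF v_in[of i]] by linarith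
    then have ya: "?y \<in> admissible" using xa t' by (auto simp: admissible_def X_space_def)
    have act: "action e z (j - 1) (j + 1) = e (z (j - 1)) (z j) + e (z j) (z (j + 1))" for z
      using action_first[of "j - 1" "j + 1" e z] by simp
    have "action e x (j - 1) (j + 1) \<le> action e ?y (j - 1) (j + 1)"
      by (rule local_minimizerD[OF x ya]) auto
    then show ?thesis
      using one_site_clamp[OF xi xi, of "j - 1" t "j + 1"] by (simp add: act t'_def)
  qed
  then show ?thesis using that \<delta>(1) by blast
qed

end

section \<open>Choice of the radii and of the gaps\<close>

lemma increments_realizable:
  fixes N :: "int \<Rightarrow> int"
  obtains k :: "int \<Rightarrow> int" where "k 0 = 0" "\<And>i. k (i + 1) = k i + N i"
proof -
  define k where "k i = (\<Sum>j\<in>{0..<i}. N j) - (\<Sum>j\<in>{i..<0}. N j)" for i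
  have "k 0 = 0" by (simp add: k_def)
  moreover have "k (i + 1) = k i + N i" for i
  proof (cases "0 \<le> i")
    case True
    then have "{0..<i + 1} = insert i {0..<i}" by auto
    then show ?thesis using True by (simp add: k_def)
  next
    case False
    then have "{i..<0} = insert i {i + 1..<0}" by auto
    then show ?thesis using False by (simp add: k_def)
  qed
  ultimately show thesis using that by blast
qed

lemma increasing_blocks_cover:
  fixes k :: "int \<Rightarrow> int"
  assumes k: "\<And>i. k i < k (i + 1)"
  shows "\<exists>i. k i \<le> j \<and> j < k (i + 1)"
proof (cases "k 0 \<le> j")
  case True
  then show ?thesis
  proof (induction j rule: int_ge_induct)
    case base
    then show ?case using k by blast
  next
    case (step j)
    then obtain i where i: "k i \<le> j" "j < k (i + 1)" by blast
    show ?case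
    proof (cases "j + 1 < k (i + 1)")
      case True
      then show ?thesis using i by (intro exI[of _ i]) simp
    next
      case False
      then show ?thesis using i k[of "i + 1"] by (intro exI[of _ "i + 1"]) simp
    qed
  qed
next
  case False
  then have "j \<le> k 0" by simp
  then show ?thesis
  proof (induction j rule: int_le_induct)
    case base
    then show ?case using k by blast
  next
    case (step j)
    then obtain i where i: "k i \<le> j" "j < k (i + 1)" by blast
    show ?case
    proof (cases "k i \<le> j - 1")
      case True
      then show ?thesis using i by (intro exI[of _ i]) simp
    next
      case False
      then show ?thesis using i k[of "i - 1"] by (intro exI[of _ "i - 1"]) simp
    qed
  qed
qed

lemma sum_window_half_powers: "(\<Sum>i\<in>window n. (1/2::real) ^ nat \<bar>i\<bar>) \<le> 3"
proof -
  have "(\<Sum>i\<in>window n. (1/2::real) ^ nat \<bar>i\<bar>) = 3 - 2 * (1/2) ^ n"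
  proof (induction n)
    case 0
    have "window 0 = {0}" by (auto simp: window_def)
    then show ?case by simp
  next
    case (Suc n)
    have "window (Suc n) = insert (int (Suc n)) (insert (- int (Suc n)) (window n))"
      by (auto simp: window_def)
    moreover have "int (Suc n) \<notin> insert (- int (Suc n)) (window n)" "- int (Suc n) \<notin> window n"
      by (auto simp: window_def)
    moreover have "nat \<bar>int (Suc n)\<bar> = Suc n" "nat \<bar>- int (Suc n)\<bar> = Suc n" by auto
    ultimately show ?case using Suc
      by (simp del: of_nat_Suc)
  qed
  then show ?thesis by simp
qed

lemma summable_on_of_half_powers:
  fixes \<rho> :: "int \<Rightarrow> real"
  assumes "\<And>i. 0 \<le> \<rho> i" "\<And>i. \<rho> i \<le> (1/2) ^ nat \<bar>i\<bar>"
  shows "\<rho> summable_on A"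
proof (rule nonneg_bdd_above_summable_on)
  show "bdd_above (sum \<rho> ` {F. F \<subseteq> A \<and> finite F})"
  proof (rule bdd_aboveI2)
    fix F assume "F \<in> {F. F \<subseteq> A \<and> finite F}"
    then have F: "finite F" by simp
    define n where "n = (\<Sum>i\<in>F. nat \<bar>i\<bar>)"
    have "F \<subseteq> window n"
    proof
      fix i assume "i \<in> F"
      then have "nat \<bar>i\<bar> \<le> n" unfolding n_def using F by (intro member_le_sum) auto
      then show "i \<in> window n" by (simp add: window_def)
    qed
    then have "sum \<rho> F \<le> sum \<rho> (window n)" using assms(1) by (intro sum_mono2) auto
    also have "\<dots> \<le> (\<Sum>i\<in>window n. (1/2) ^ nat \<bar>i\<bar>)" by (intro sum_mono assms(2))
    also have "\<dots> \<le> 3" by (rule sum_window_half_powers)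
    finally show "sum \<rho> F \<le> 3" .
  qed
qed (use assms in auto)

context two_well
begin

text \<open>
  Waiting at the target is free, so one near-optimal chain serves for all larger lengths.
\<close>

lemma near_optimal_extendable_path:
  assumes ab: "a \<in> {u0, u1}" "b \<in> {u0, u1}" and "0 < \<tau>"
  obtains P M where "P \<in> X" "P 0 = a" "(0::int) \<le> M"
    "\<And>N. M \<le> N \<Longrightarrow> P N = b" "\<And>N. M \<le> N \<Longrightarrow> action e P 0 N \<le> D a b + \<tau>"
    "a = b \<Longrightarrow> P = (\<lambda>_. a)"
proof (cases "a = b")
  case True
  have a: "a \<in> {u0..u1}" using ab by auto
  show thesis
    by (rule that[of "\<lambda>_. a" 0])
      (use True ab a diag_end[OF ab(1)] D_self[OF a] \<open>0 < \<tau>\<close> in \<open>auto simp: X_space_def action_const\<close>)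
next
  case False
  have abi: "a \<in> {u0..u1}" "b \<in> {u0..u1}" using ab by auto
  obtain x m n where x: "m < n" "x \<in> X" "x m = a" "x n = b" "action e x m n < D a b + \<tau>"
    by (rule D_approx[OF abi \<open>0 < \<tau>\<close>])
  define P where "P = (\<lambda>j. if j \<le> n - m then x (j + m) else b)"
  have Pb: "P j = b" if "n - m \<le> j" for j using that x by (cases "j = n - m") (auto simp: P_def)
  show thesis
  proof (rule that[of P "n - m"])
    show "P \<in> X" using x(2) abi by (auto simp: P_def X_space_def)
    fix N assume N: "n - m \<le> N"
    have "action e P 0 N = action e P 0 (n - m) + action e P (n - m) N"
      using x(1) N by (intro action_split) auto
    moreover have "action e P (n - m) N = action e (\<lambda>_. b) (n - m) N"
      by (rule action_cong) (use Pb in auto)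
    moreover have "action e P 0 (n - m) = action e (\<lambda>j. x (j + m)) 0 (n - m)"
      by (rule action_cong) (simp add: P_def)
    ultimately have "action e P 0 N = action e x m n"
      using N diag_end[OF ab(2)] action_shift[of e x m 0 "n - m"] by (simp add: action_const)
    then show "action e P 0 N \<le> D a b + \<tau>" using x(5) by simp
  qed (use x Pb False in \<open>auto simp: P_def\<close>)
qed

text \<open>
  If \<open>a = b\<close>, the defect is the cost of a loop, and every small radius works. Otherwise \<open>w\<close> is the
  source or the target of the passage, and points of positive defect accumulate there.
\<close>

lemma small_radius_with_defect:
  assumes abw: "a \<in> {u0, u1}" "b \<in> {u0, u1}" "w = a \<or> w = b"
    and gap: "a \<noteq> b \<Longrightarrow> \<exists>y\<in>{u0..u1}. 0 < defect a b y"
    and "0 < B" "B \<le> (u1 - u0) / 2"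
  shows "\<exists>r. 0 < r \<and> r < B \<and> 0 < defect a b (if w = u0 then u0 + r else u1 - r)"
proof (cases "a = b")
  case True
  define y where "y = (if w = u0 then u0 + B / 2 else u1 - B / 2)"
  have y: "u0 < y" "y < u1" using \<open>0 < B\<close> \<open>B \<le> (u1 - u0) / 2\<close> by (auto simp: y_def)
  have a: "a \<in> {u0..u1}" using abw by auto
  have "e y y \<le> D y a + D a y" by (rule D_loop) (use y a in auto)
  then have "0 < defect a b y"
    using True diag_pos[OF y] D_self[OF a] diag_end[OF abw(1)] by (simp add: defect_def)
  then show ?thesis using \<open>0 < B\<close> by (intro exI[of _ "B / 2"]) (simp add: y_def)
next
  case False
  obtain y0 where y0: "y0 \<in> {u0..u1}" "0 < defect a b y0" using gap[OF False] by blast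
  obtain y where y: "u0 < y" "y < u1" "\<bar>y - w\<bar> < B" "0 < defect a b y"
    using abw(3)
  proof
    assume "w = a"
    then show thesis using defect_pos_near_source[OF abw(1,2) False y0 \<open>0 < B\<close>] that by blast
  next
    assume "w = b"
    then show thesis using defect_pos_near_target[OF abw(1,2) False y0 \<open>0 < B\<close>] that by blast
  qed
  have "w = u0 \<or> w = u1" using abw by auto
  then have "y = (if w = u0 then u0 + \<bar>y - w\<bar> else u1 - \<bar>y - w\<bar>)" using y(1,2) u0_less_u1 by auto
  moreover have "0 < \<bar>y - w\<bar>" using y abw by auto
  ultimately show ?thesis using y by (intro exI[of _ "\<bar>y - w\<bar>"]) auto
qed

text \<open>
  The order of the choices matters: the radii \<open>\<rho>\<close> are fixed first, independently of the gaps; they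
  determine the defects, these the tolerances \<open>\<eta>\<close>, \<open>\<zeta>\<close>, and these the lengths of the blocks.
\<close>

lemma rigid_itinerary_exists:
  fixes v :: "int \<Rightarrow> real"
  assumes v: "\<And>i. v i \<in> {u0, u1}" and no_isolated: "\<And>i. v (i - 1) = v i \<or> v i = v (i + 1)"
    and gap: "\<And>p q. p \<in> {u0, u1} \<Longrightarrow> q \<in> {u0, u1} \<Longrightarrow> p \<noteq> q \<Longrightarrow> \<exists>y\<in>{u0..u1}. 0 < defect p q y"
    and "0 < \<epsilon>"
  obtains k \<rho> \<eta> \<zeta> \<mu> T where "rigid_itinerary e u0 u1 L v k \<rho> \<eta> \<zeta> \<mu> T" "k 0 = 0"
    "\<And>i. \<rho> i < \<epsilon>" "\<And>i. \<rho> i \<le> (1/2) ^ nat \<bar>i\<bar>"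
proof -
  define \<Delta> where "\<Delta> = D u0 u1 + D u1 u0"
  have \<Delta>: "0 < \<Delta>" unfolding \<Delta>_def by (rule round_trip_pos)
  define B where "B i = min (min \<epsilon> ((u1 - u0) / 2)) (min (\<Delta> / (12 * L)) ((1/2) ^ nat \<bar>i\<bar>))" for i :: int
  have B: "0 < B i" "B i \<le> (u1 - u0) / 2" for i
    using \<Delta> L_pos u0_less_u1 \<open>0 < \<epsilon>\<close> by (simp add: B_def) (simp add: B_def min_def)
  have "\<exists>r. 0 < r \<and> r < B i \<and> 0 < defect (v (i - 1)) (v (i + 1)) (if v i = u0 then u0 + r else u1 - r)" for i
    by (rule small_radius_with_defect[OF v v _ gap[OF v v] B]) (use no_isolated[of i] in auto)
  then obtain \<rho> where \<rho>: "\<And>i. 0 < \<rho> i" "\<And>i. \<rho> i < B i"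
    "\<And>i. 0 < defect (v (i - 1)) (v (i + 1)) (if v i = u0 then u0 + \<rho> i else u1 - \<rho> i)"
    by metis
  define G where "G i = defect (v (i - 1)) (v (i + 1)) (if v i = u0 then u0 + \<rho> i else u1 - \<rho> i)" for i
  define \<eta> where "\<eta> i = min (\<rho> i / 2) (G i / (4 * L + 3))" for i
  have G: "0 < G i" for i using \<rho>(3) by (simp add: G_def)
  have \<eta>_pos: "0 < \<eta> i" for i using \<rho>(1)[of i] G[of i] L_pos by (simp add: \<eta>_def)
  have \<eta>_less: "\<eta> i < \<rho> i" for i
    using \<rho>(1)[of i] min.cobounded1[of "\<rho> i / 2" "G i / (4 * L + 3)"] by (simp add: \<eta>_def)
  have \<eta>_G: "(4 * L + 2) * \<eta> i < G i" for i
  proof -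
    have "\<eta> i \<le> G i / (4 * L + 3)" by (simp add: \<eta>_def)
    then have "(4 * L + 3) * \<eta> i \<le> G i" using L_pos by (simp add: field_simps)
    then show ?thesis using \<eta>_pos[of i] by (simp add: algebra_simps)
  qed
  define \<zeta> where "\<zeta> i = min (min (\<eta> (i - 1)) (\<eta> i)) (min (\<eta> (i + 1)) (\<eta> (i + 2)))" for i
  have \<zeta>_pos: "0 < \<zeta> i" for i using \<eta>_pos by (simp add: \<zeta>_def)
  have "\<exists>\<mu>>0. \<forall>t\<in>{u0..u1}. \<not> \<bar>t - u0\<bar> < \<zeta> i \<longrightarrow> \<not> \<bar>t - u1\<bar> < \<zeta> i \<longrightarrow> \<mu> \<le> e t t" for i
    using diag_lower_bound[OF \<zeta>_pos[of i]] by metis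
  then obtain \<mu> where \<mu>: "\<And>i. 0 < \<mu> i"
    "\<And>i t. t \<in> {u0..u1} \<Longrightarrow> \<not> \<bar>t - u0\<bar> < \<zeta> i \<Longrightarrow> \<not> \<bar>t - u1\<bar> < \<zeta> i \<Longrightarrow> \<mu> i \<le> e t t"
    by metis
  define \<tau> where "\<tau> i = min (\<eta> i) (\<eta> (i + 1))" for i
  have \<tau>: "0 < \<tau> i" for i using \<eta>_pos by (simp add: \<tau>_def)
  have "\<exists>P M. P \<in> X \<and> P 0 = v i \<and> (0::int) \<le> M \<and> (\<forall>N\<ge>M. P N = v (i + 1)) \<and>
      (\<forall>N\<ge>M. action e P 0 N \<le> D (v i) (v (i + 1)) + \<tau> i) \<and> (v i = v (i + 1) \<longrightarrow> P = (\<lambda>_. v i))" for i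
    by (rule near_optimal_extendable_path[OF v[of i] v[of "i + 1"] \<tau>[of i]]) blast
  then obtain P M where P: "\<And>i. P i \<in> X" "\<And>i. P i 0 = v i" "\<And>i. (0::int) \<le> M i"
    "\<And>i N. M i \<le> N \<Longrightarrow> P i N = v (i + 1)"
    "\<And>i N. M i \<le> N \<Longrightarrow> action e (P i) 0 N \<le> D (v i) (v (i + 1)) + \<tau> i"
    "\<And>i. v i = v (i + 1) \<Longrightarrow> P i = (\<lambda>_. v i)"
    by metis
  \<comment> \<open>Long enough for the near-optimal path and for the escape estimate.\<close>
  define N where "N i = M i + 1 + \<lceil>2 * L * (u1 - u0) / \<mu> i\<rceil>" for i
  have frac: "0 < 2 * L * (u1 - u0) / \<mu> i" for i using L_pos u0_less_u1 \<mu>(1) by simp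
  then have "0 < \<lceil>2 * L * (u1 - u0) / \<mu> i\<rceil>" for i by (simp only: zero_less_ceiling)
  then have N: "M i \<le> N i" "0 < N i" for i
    unfolding N_def using P(3)[of i] by (smt (verit))+
  have N_long: "2 * L * (u1 - u0) < of_int (N i) * \<mu> i" for i
  proof -
    have "2 * L * (u1 - u0) / \<mu> i \<le> of_int \<lceil>2 * L * (u1 - u0) / \<mu> i\<rceil>" by (rule le_of_int_ceiling)
    also have "\<dots> < of_int (N i)" using P(3)[of i] by (simp add: N_def)
    finally show ?thesis using \<mu>(1)[of i] by (simp add: field_simps)
  qed
  obtain k where k: "k 0 = 0" "\<And>i. k (i + 1) = k i + N i" using increments_realizable[of N] by blast
  have k_less: "k i < k (i + 1)" for i using k(2) N(2) by simp
  interpret itinerary e u0 u1 L v k \<rho>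
    by unfold_locales (use v k_less \<rho>(1) less_le_trans[OF \<rho>(2) B(2)] in blast)+
  obtain I where I: "\<And>j. k (I j) \<le> j" "\<And>j. j < k (I j + 1)"
    using increasing_blocks_cover[of k, OF k_less] by metis
  define T where "T j = P (I j) (j - k (I j))" for j
  \<comment> \<open>Each time \<open>j\<close> lies in exactly one block, whose index is \<open>I j\<close>; the path of that block is shifted to it.\<close>
  have I_eq: "I j = i" if "k i \<le> j" "j < k (i + 1)" for i j
    using k_mono[of "i + 1" "I j"] k_mono[of "I j + 1" i] I[of j] that by linarith
  have T_eq: "T j = P i (j - k i)" if "k i \<le> j" "j \<le> k (i + 1)" for i j
  proof (cases "j = k (i + 1)")
    case True
    then have "T j = v (i + 1)" using I_eq[of "i + 1" j] k_less[of "i + 1"] P(2) by (simp add: T_def)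
    also have "\<dots> = P i (j - k i)" using True k(2)[of i] P(4)[OF N(1)] by simp
    finally show ?thesis .
  next
    case False
    then show ?thesis using I_eq[of i j] that by (simp add: T_def)
  qed
  have "rigid_itinerary e u0 u1 L v k \<rho> \<eta> \<zeta> \<mu> T"
  proof unfold_locales
    fix i j
    show "v (i - 1) = v i \<or> v i = v (i + 1)" by (rule no_isolated)
    have "\<rho> i < \<Delta> / (12 * L)" using \<rho>(2)[of i] by (simp add: B_def)
    then show "12 * (L * \<rho> i) < D u0 u1 + D u1 u0" using L_pos by (simp add: \<Delta>_def field_simps)
    show "0 < \<eta> i" "\<eta> i < \<rho> i" by (rule \<eta>_pos, rule \<eta>_less)
    show "(4 * L + 2) * \<eta> i < defect (v (i - 1)) (v (i + 1)) (if v i = u0 then u0 + \<rho> i else u1 - \<rho> i)"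
      using \<eta>_G[of i] by (simp only: G_def)
    show "\<zeta> i \<le> \<eta> (i - 1)" "\<zeta> i \<le> \<eta> i" "\<zeta> i \<le> \<eta> (i + 1)" "\<zeta> i \<le> \<eta> (i + 2)"
      by (simp_all add: \<zeta>_def)
    show "\<mu> i \<le> e t t" if "t \<in> {u0..u1}" "\<not> \<bar>t - u0\<bar> < \<zeta> i" "\<not> \<bar>t - u1\<bar> < \<zeta> i" for t
      by (rule \<mu>(2)[OF that])
    show "2 * L * (u1 - u0) < of_int (k (i + 1) - k i) * \<mu> i" using N_long k(2) by simp
    show "T \<in> X" using P(1) by (auto simp: T_def X_space_def)
    show "T (k i) = v i" using T_eq[of i "k i"] k_less[of i] P(2) by simp
    have "action e T (k i) (k (i + 1)) = action e (\<lambda>j. P i (j + (- k i))) (k i) (k (i + 1))"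
      by (rule action_cong) (simp add: T_eq)
    also have "\<dots> = action e (P i) 0 (N i)"
      unfolding action_shift using k(2)[of i] by simp
    also have "\<dots> \<le> D (v i) (v (i + 1)) + \<tau> i" by (rule P(5)[OF N(1)])
    finally show "action e T (k i) (k (i + 1)) \<le> D (v i) (v (i + 1)) + min (\<eta> i) (\<eta> (i + 1))"
      by (simp add: \<tau>_def)
    show "T j = v i" if "v i = v (i + 1)" "k i \<le> j" "j \<le> k (i + 1)"
      using T_eq[OF that(2,3)] P(6)[OF that(1)] by simp
  qed
  moreover have "\<rho> i < \<epsilon>" "\<rho> i \<le> (1/2) ^ nat \<bar>i\<bar>" for i using \<rho>(2)[of i] by (auto simp: B_def)
  ultimately show thesis using that k(1) by blast
qed

lemma continuous_action: "continuous_on S (\<lambda>x. action e x m n)"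
  unfolding action_def
proof (intro continuous_on_sum)
  fix i
  have c: "((\<lambda>y::int \<Rightarrow> real. y j) \<longlongrightarrow> x j) (at x within S)" for x j
    using continuous_on_subset[OF continuous_on_product_coordinates[of j]]
    by (metis UNIV_I continuous_on_def subset_UNIV tendsto_within_subset)
  show "continuous_on S (\<lambda>x. e (x i) (x (i + 1)))"
    unfolding continuous_on_def by (intro ballI tendsto_e c)
qed

end

context itinerary
begin

lemma compact_admissible: "compact admissible"
proof -
  have "admissible = {x. \<forall>i. x i \<in> {u0..u1}} \<inter> {x. \<forall>i. \<bar>x (k i) - v i\<bar> \<le> \<rho> i}"
    by (auto simp: admissible_def X_space_def)
  moreover have "closed {x :: int \<Rightarrow> real. \<forall>i. \<bar>x (k i) - v i\<bar> \<le> \<rho> i}"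
    by (intro closed_Collect_all closed_Collect_le continuous_intros continuous_on_product_coordinates)
  ultimately show ?thesis using compact_box[of "\<lambda>_. u0" "\<lambda>_. u1"] by (simp add: compact_Int_closed)
qed

lemma k_ge: "0 \<le> i \<Longrightarrow> k 0 = 0 \<Longrightarrow> i \<le> k i"
proof (induction i rule: int_ge_induct)
  case (step i)
  then show ?case using k_less[of i] by simp
qed simp

lemma k_le: "i \<le> 0 \<Longrightarrow> k 0 = 0 \<Longrightarrow> k i \<le> i"
proof (induction i rule: int_le_induct)
  case (step i)
  then show ?case using k_less[of "i - 1"] by simp
qed simp

end

context rigid_itinerary
begin

text \<open>
  The numbers \<open>W\<close> stand for the renormalization constants of the blocks. Two configurations that
  differ in finitely many places have partial sums that eventually differ by a constant, the
  difference of their actions; so minimality of the limit, being finite, passes to finite modifications.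
\<close>

lemma renormalized_action:
  fixes W :: "int \<Rightarrow> real"
  defines "B \<equiv> \<lambda>x i. action e x (k i) (k (i + 1)) - W i"
  defines "P \<equiv> \<lambda>x n. ereal (\<Sum>i\<in>window n. B x i)"
  assumes k0: "k 0 = 0" and \<rho>: "\<And>i. \<rho> i \<le> (1/2) ^ nat \<bar>i\<bar>"
    and lower: "\<And>x i. x \<in> admissible \<Longrightarrow> - (L * (\<rho> i + \<rho> (i + 1))) \<le> B x i"
    and upper: "\<And>i. B T i \<le> \<eta> i + L * (\<rho> i + \<rho> (i + 1))"
  shows "\<And>x. x \<in> admissible \<Longrightarrow> convergent (P x)"
    and "\<exists>x\<in>admissible. \<forall>y\<in>admissible. lim (P x) \<le> lim (P y)"
    and "\<And>x. x \<in> admissible \<Longrightarrow> (\<And>y. y \<in> admissible \<Longrightarrow> lim (P x) \<le> lim (P y)) \<Longrightarrow> local_minimizer x"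
proof -
  define s where "s i = L * (\<rho> i + \<rho> (i + 1))" for i
  have s0: "0 \<le> s i" for i using L_pos \<rho>_pos[of i] \<rho>_pos[of "i + 1"] by (simp add: s_def)
  have s_le: "s i \<le> 3 * L * (1/2) ^ nat \<bar>i\<bar>" for i
  proof -
    have "(1/2::real) ^ Suc (nat \<bar>i + 1\<bar>) \<le> (1/2) ^ nat \<bar>i\<bar>" by (rule power_decreasing) auto
    then have "\<rho> i + \<rho> (i + 1) \<le> 3 * (1/2) ^ nat \<bar>i\<bar>" using \<rho>[of i] \<rho>[of "i + 1"] by simp
    then show ?thesis using L_pos by (simp add: s_def mult.assoc)
  qed
  have s_sum: "(\<Sum>i\<in>window n. s i) \<le> 9 * L" for n
  proof -
    have "(\<Sum>i\<in>window n. s i) \<le> (\<Sum>i\<in>window n. 3 * L * (1/2) ^ nat \<bar>i\<bar>)" by (intro sum_mono s_le)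
    also have "\<dots> = 3 * L * (\<Sum>i\<in>window n. (1/2) ^ nat \<bar>i\<bar>)" by (simp add: sum_distrib_left)
    also have "\<dots> \<le> 3 * L * 3" using L_pos by (intro mult_left_mono sum_window_half_powers) auto
    finally show ?thesis by simp
  qed
  have T_sum: "(\<Sum>i\<in>window n. B T i) \<le> 3 + 9 * L" for n
  proof -
    have "(\<Sum>i\<in>window n. B T i) \<le> (\<Sum>i\<in>window n. (1/2) ^ nat \<bar>i\<bar> + s i)"
    proof (rule sum_mono)
      fix i
      show "B T i \<le> (1/2) ^ nat \<bar>i\<bar> + s i" using upper[of i] \<eta>(2)[of i] \<rho>[of i] by (simp add: s_def)
    qed
    then show ?thesis using s_sum[of n] sum_window_half_powers[of n] by (simp add: sum.distrib)
  qed
  have cont: "continuous_on admissible (\<lambda>x. B x i)" for i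
    unfolding B_def by (intro continuous_intros continuous_action)
  note series = almost_nonneg_series_minimizer[OF compact_admissible, of B s "9 * L" T "3 + 9 * L",
      OF cont _ s0 s_sum T_admissible T_sum]
  have lower': "- s i \<le> B x i" if "x \<in> admissible" for x i using lower[OF that] by (simp add: s_def)
  show "convergent (P x)" if "x \<in> admissible" for x
    unfolding P_def by (rule series(1)[OF lower' that])
  show "\<exists>x\<in>admissible. \<forall>y\<in>admissible. lim (P x) \<le> lim (P y)"
    unfolding P_def by (rule series(2)[OF lower'])
  show "local_minimizer x" if x: "x \<in> admissible" "\<And>y. y \<in> admissible \<Longrightarrow> lim (P x) \<le> lim (P y)" for x
    unfolding local_minimizer_def
  proof (intro conjI ballI allI impI x(1))
    fix y m n
    assume y: "y \<in> admissible" and mn: "m \<le> n" and eq: "\<forall>j. j \<le> m \<or> n \<le> j \<longrightarrow> y j = x j"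
    obtain r where r: "(\<lambda>n. \<Sum>i\<in>window n. B x i) \<longlonglongrightarrow> r"
      using series(3)[OF lower' x(1) x(2)[OF T_admissible, unfolded P_def]] by blast
    define \<delta> where "\<delta> = action e y m n - action e x m n"
    define N0 where "N0 = nat (\<bar>m\<bar> + \<bar>n\<bar>)"
    have diff: "(\<Sum>i\<in>window N. B y i) = (\<Sum>i\<in>window N. B x i) + \<delta>" if N: "N0 \<le> N" for N
    proof -
      have w: "window N = {- int N..<int N + 1}" by (auto simp: window_def)
      have tel: "(\<Sum>i\<in>window N. action e z (k i) (k (i + 1))) = action e z (k (- int N)) (k (int N + 1))" for z
        using action_telescope[of k "- int N" "int N + 1" e z] k_less by (simp add: w less_imp_le)
      have bd: "k (- int N) \<le> m" "n \<le> k (int N + 1)"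
        using k_le[of "- int N"] k_ge[of "int N + 1"] k0 N by (auto simp: N0_def)
      have split: "action e z (k (- int N)) (k (int N + 1)) =
          action e z (k (- int N)) m + action e z m n + action e z n (k (int N + 1))" for z
        using bd mn action_split[of "k (- int N)" m "k (int N + 1)" e z]
          action_split[of m n "k (int N + 1)" e z] by simp
      have "action e y (k (- int N)) m = action e x (k (- int N)) m"
        "action e y n (k (int N + 1)) = action e x n (k (int N + 1))"
        using eq by (auto intro!: action_cong)
      then have "(\<Sum>i\<in>window N. action e y (k i) (k (i + 1)))
          = (\<Sum>i\<in>window N. action e x (k i) (k (i + 1))) + \<delta>"
        unfolding tel split by (simp add: \<delta>_def)
      then show ?thesis by (simp add: B_def sum_subtractf)
    qed
    have "(\<lambda>n. (\<Sum>i\<in>window n. B x i) + \<delta>) \<longlonglongrightarrow> r + \<delta>" by (intro tendsto_intros r)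
    then have "(\<lambda>n. \<Sum>i\<in>window n. B y i) \<longlonglongrightarrow> r + \<delta>"
      by (rule Lim_transform_eventually)
        (use diff in \<open>auto simp: eventually_at_top_linorder intro!: exI[of _ N0]\<close>)
    then have "lim (P y) = ereal (r + \<delta>)" unfolding P_def by (intro limI) (simp add: lim_ereal)
    moreover have "lim (P x) = ereal r" unfolding P_def using r by (intro limI) (simp add: lim_ereal)
    ultimately have "0 \<le> \<delta>" using x(2)[OF y] by simp
    then show "action e x m n \<le> action e y m n" by (simp add: \<delta>_def)
  qed
qed

end

section \<open>Stationarity of the constrained minimizers\<close>

lemma X_constr_eq_admissible:
  assumes "itinerary e u0 u1 L (\<lambda>i. if i \<in> A0 then u0 else u1) k \<rho>"
    and "A0 \<inter> A1 = {}" "A0 \<union> A1 = UNIV"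
  shows "X_constr u0 u1 A0 A1 k \<rho> = itinerary.admissible u0 u1 (\<lambda>i. if i \<in> A0 then u0 else u1) k \<rho>"
proof -
  interpret itinerary e u0 u1 L "\<lambda>i. if i \<in> A0 then u0 else u1" k \<rho> by (rule assms(1))
  have mem: "i \<in> A1 \<longleftrightarrow> i \<notin> A0" for i using assms(2,3) by blast
  have "0 \<in> A0 \<or> 0 \<in> A1" using assms(3) by blast
  then have "x \<in> X" if "x \<in> X_constr u0 u1 A0 A1 k \<rho>" for x
    using that by (auto simp: X_constr_def Y_space_def)
  moreover have "x \<in> X_constr u0 u1 A0 A1 k \<rho> \<longleftrightarrow> x \<in> admissible" if "x \<in> X" for x
    using that by (auto simp: X_constr_def admissible_def Y_space_def mem)
  moreover have "x \<in> X" if "x \<in> admissible" for x using that by (simp add: admissible_def)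
  ultimately show ?thesis by blast
qed

text \<open>
  The renormalization constant of a switch is an infimum over chains whose end points are \<open>\<rho>\<close>-close
  to the two rest points, hence it differs little from the barrier cost.
\<close>

lemma switch_cost_lower:
  fixes h :: "real \<Rightarrow> real \<Rightarrow> real"
  assumes tw: "two_well (\<lambda>a b. h a b - c) u0 u1 L" and "k i < k (i + 1)"
    and "a \<in> {u0..u1}" "b \<in> {u0..u1}" "0 < \<rho> i" "0 < \<rho> (i + 1)"
  defines "Y \<equiv> Y_space u0 u1 a (k i) (\<rho> i) \<inter> Y_space u0 u1 b (k (i + 1)) (\<rho> (i + 1))"
    and "W \<equiv> switch_cost h u0 u1 a b k \<rho> i - of_int (k (i + 1) - k i) * c"
  shows "\<And>x. x \<in> Y \<Longrightarrow> W \<le> action (\<lambda>a b. h a b - c) x (k i) (k (i + 1))"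
    and "barrier_cost (\<lambda>a b. h a b - c) u0 u1 a b - L * (\<rho> i + \<rho> (i + 1)) \<le> W"
proof -
  interpret two_well "\<lambda>a b. h a b - c" u0 u1 L by (rule tw)
  have act: "action h x (k i) (k (i + 1)) =
      action (\<lambda>a b. h a b - c) x (k i) (k (i + 1)) + of_int (k (i + 1) - k i) * c" for x
    using assms(2) by (simp add: action_minus_const)
  have low: "D a b - L * (\<rho> i + \<rho> (i + 1)) + of_int (k (i + 1) - k i) * c \<le> action h x (k i) (k (i + 1))"
    if "x \<in> Y" for x
  proof -
    have x: "x \<in> X" "\<bar>x (k i) - a\<bar> \<le> \<rho> i" "\<bar>x (k (i + 1)) - b\<bar> \<le> \<rho> (i + 1)"
      using that by (auto simp: Y_def Y_space_def)
    have xi: "x j \<in> {u0..u1}" for j using x(1) by (auto simp: X_space_def)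
    have "D (x (k i)) (x (k (i + 1))) \<le> action (\<lambda>a b. h a b - c) x (k i) (k (i + 1))"
      by (rule D_le[OF assms(2) x(1)])
    moreover have "D a b - L * (\<bar>a - x (k i)\<bar> + \<bar>b - x (k (i + 1))\<bar>) \<le> D (x (k i)) (x (k (i + 1)))"
      by (rule D_near[OF assms(3,4) xi xi])
    moreover have "L * (\<bar>a - x (k i)\<bar> + \<bar>b - x (k (i + 1))\<bar>) \<le> L * (\<rho> i + \<rho> (i + 1))"
      using x L_pos by (intro mult_left_mono) (auto simp: abs_minus_commute)
    ultimately show ?thesis by (simp add: act)
  qed
  define z where "z = (\<lambda>j. if j \<le> k i then a else b)"
  have "z \<in> Y" using assms(2-6) by (auto simp: z_def Y_def Y_space_def X_space_def)
  then have ne: "Y \<noteq> {}" by blast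
  have bdd: "bdd_below ((\<lambda>x. action h x (k i) (k (i + 1))) ` Y)"
    by (rule bdd_belowI2) (rule low)
  show "W \<le> action (\<lambda>a b. h a b - c) x (k i) (k (i + 1))" if "x \<in> Y" for x
    using cINF_lower[OF bdd that] by (simp add: W_def switch_cost_def Y_def[symmetric] act)
  have "D a b - L * (\<rho> i + \<rho> (i + 1)) + of_int (k (i + 1) - k i) * c
      \<le> (INF x\<in>Y. action h x (k i) (k (i + 1)))"
    by (rule cINF_greatest[OF ne]) (rule low)
  then show "D a b - L * (\<rho> i + \<rho> (i + 1)) \<le> W"
    by (simp add: W_def switch_cost_def Y_def[symmetric])
qed

lemma (in twist_potential) stationary_if_one_site_minimal:
  assumes "\<And>j. \<exists>\<delta>>0. \<forall>t. \<bar>t - x j\<bar> < \<delta> \<longrightarrow>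
    h (x (j - 1)) (x j) + h (x j) (x (j + 1)) \<le> h (x (j - 1)) t + h t (x (j + 1))"
  shows "stationary h x"
  unfolding stationary_def
proof
  fix j
  obtain \<theta> where \<theta>: "\<And>\<xi>'. convex_on UNIV (\<lambda>\<xi>. \<theta> * \<xi>\<^sup>2 / 2 - h \<xi> \<xi>')"
    "\<And>\<xi>. convex_on UNIV (\<lambda>\<xi>'. \<theta> * \<xi>'\<^sup>2 / 2 - h \<xi> \<xi>')" using h6 by blast
  obtain \<delta> where "0 < \<delta>" "\<And>t. \<bar>t - x j\<bar> < \<delta> \<Longrightarrow>
    h (x (j - 1)) (x j) + h (x j) (x (j + 1)) \<le> h (x (j - 1)) t + h t (x (j + 1))"
    using assms by blast
  from semiconcave_local_min_left_derivatives[OF \<theta>(2) \<theta>(1) this]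
  show "\<exists>d2 d1. ((\<lambda>t. h (x (j - 1)) t) has_real_derivative d2) (at_left (x j)) \<and>
        ((\<lambda>t. h t (x (j + 1))) has_real_derivative d1) (at_left (x j)) \<and> d2 + d1 = 0" .
qed

text \<open>
  The neighborhoods of the two rest points are disjoint, so the visits reveal the itinerary.
\<close>

lemma transitions_eq_switches:
  assumes "A0 \<inter> A1 = {}" "A0 \<union> A1 = UNIV" "u0 < u1" "\<And>i. \<rho> i < (u1 - u0) / 2"
    and x: "x \<in> X_constr u0 u1 A0 A1 k \<rho>"
  shows "has_transitions u0 u1 k \<rho> x (ecard (switches A0 A1))"
proof -
  have mem: "i \<in> A1 \<longleftrightarrow> i \<notin> A0" for i using assms(1,2) by blast
  have near0: "\<bar>x (k i) - u0\<bar> \<le> \<rho> i" if "i \<in> A0" for i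
    using x that by (auto simp: X_constr_def Y_space_def)
  have near1: "\<bar>x (k i) - u1\<bar> \<le> \<rho> i" if "i \<notin> A0" for i
    using x that mem by (auto simp: X_constr_def Y_space_def)
  have disj: "\<not> (\<bar>x (k i) - u0\<bar> \<le> \<rho> i \<and> \<bar>x (k i) - u1\<bar> \<le> \<rho> i)" for i
    using assms(4)[of i] by (auto simp: abs_le_iff)
  have "visits k \<rho> x u0 i \<longleftrightarrow> i \<in> A0" "visits k \<rho> x u1 i \<longleftrightarrow> i \<in> A1" for i
    using near0[of i] near1[of i] disj[of i] by (auto simp: visits_def mem)
  then show ?thesis by (simp add: has_transitions_def switches_def mem)
qed

theorem theorem5p2:
  fixes h :: "real \<Rightarrow> real \<Rightarrow> real" and u0 u1 :: real and A0 A1 :: "int set"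
  assumes "twist_potential h"
    and "neighboring_pair h u0 u1"
    and "A0 \<inter> A1 = {}" and "A0 \<union> A1 = UNIV"
    and "{u0<..<u1} - heteroclinic_values h u0 u1 \<noteq> {}"
    and "{u0<..<u1} - heteroclinic_values h u1 u0 \<noteq> {}"
    and "\<not> (\<exists>i. (i - 1 \<in> A1 \<and> i \<in> A0 \<and> i + 1 \<in> A1) \<or> (i - 1 \<in> A0 \<and> i \<in> A1 \<and> i + 1 \<in> A0))"
  shows "\<forall>\<epsilon>>0. \<exists>k \<in> K_seqs. \<exists>\<rho> \<in> P_seqs u0 u1 A0 A1.
    (\<forall>i. \<rho> i < \<epsilon>) \<and>
    (\<exists>x. J_minimizer h u0 u1 A0 A1 k \<rho> x) \<and>
    (\<forall>x. J_minimizer h u0 u1 A0 A1 k \<rho> x \<longrightarrow>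
       stationary h x \<and> has_transitions u0 u1 k \<rho> x (ecard (switches A0 A1)))"
proof (intro allI impI)
  fix \<epsilon> :: real assume \<epsilon>: "0 < \<epsilon>"
  interpret twist_potential h by (rule assms(1))
  define c where "c = min_level h"
  obtain L where tw: "two_well (\<lambda>a b. h a b - c) u0 u1 L"
    using two_well_excess[OF assms(2)] unfolding c_def by blast
  interpret W: two_well "\<lambda>a b. h a b - c" u0 u1 L by (rule tw)
  define v where "v = (\<lambda>i. if i \<in> A0 then u0 else u1)"
  have mem: "i \<in> A1 \<longleftrightarrow> i \<notin> A0" for i using assms(3,4) by blast
  have v_end: "v i \<in> {u0, u1}" for i by (simp add: v_def)
  have v_eq: "v i = v j \<longleftrightarrow> (i \<in> A0 \<longleftrightarrow> j \<in> A0)" for i j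
    using W.u0_less_u1 by (auto simp: v_def)
  have no_isolated: "v (i - 1) = v i \<or> v i = v (i + 1)" for i
    using assms(7) unfolding v_eq mem by blast
  have gap: "\<exists>y\<in>{u0..u1}. 0 < W.defect p q y" if pq: "p \<in> {u0, u1}" "q \<in> {u0, u1}" "p \<noteq> q" for p q
  proof -
    have "{u0<..<u1} - heteroclinic_values h p q \<noteq> {}" using pq assms(5,6) by auto
    then obtain y where y: "y \<in> {u0<..<u1}" "y \<notin> heteroclinic_values h p q" by blast
    then have "0 < W.defect p q y" by (rule gap_imp_defect_pos[OF tw pq])
    then show ?thesis using y(1) by (intro bexI[of _ y]) auto
  qed
  obtain k \<rho> \<eta> \<zeta> \<mu> T where rigid: "rigid_itinerary (\<lambda>a b. h a b - c) u0 u1 L v k \<rho> \<eta> \<zeta> \<mu> T"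
    and k0: "k 0 = 0" and \<rho>\<epsilon>: "\<And>i. \<rho> i < \<epsilon>" and \<rho>_half: "\<And>i. \<rho> i \<le> (1/2) ^ nat \<bar>i\<bar>"
    by (rule W.rigid_itinerary_exists[OF v_end no_isolated gap \<epsilon>]) blast+
  interpret R: rigid_itinerary "\<lambda>a b. h a b - c" u0 u1 L v k \<rho> \<eta> \<zeta> \<mu> T by (rule rigid)
  have F: "X_constr u0 u1 A0 A1 k \<rho> = R.admissible"
    using X_constr_eq_admissible[OF R.itinerary_axioms[unfolded v_def] assms(3,4)] by (simp add: v_def)
  define V where "V i = (if v i = v (i + 1) then 0
    else switch_cost h u0 u1 (v i) (v (i + 1)) k \<rho> i - of_int (k (i + 1) - k i) * c)" for i
  have B: "B_term h u0 u1 A0 A1 k \<rho> x i = action (\<lambda>a b. h a b - c) x (k i) (k (i + 1)) - V i" for x i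
    using R.k_less[of i] unfolding B_term_def V_def v_eq mem
    by (auto simp: action_minus_const v_def c_def)
  have J: "J_partial h u0 u1 A0 A1 k \<rho> x =
      (\<lambda>n. ereal (\<Sum>i\<in>window n. action (\<lambda>a b. h a b - c) x (k i) (k (i + 1)) - V i))" for x
    by (simp add: J_partial_def[abs_def] B window_def)
  have lower: "- (L * (\<rho> i + \<rho> (i + 1))) \<le> action (\<lambda>a b. h a b - c) x (k i) (k (i + 1)) - V i"
    if x: "x \<in> R.admissible" for x i
  proof (cases "v i = v (i + 1)")
    case True
    have "\<bar>x (k (i + 1)) - x (k i)\<bar> \<le> \<rho> i + \<rho> (i + 1)"
      using R.admissible_near[OF x, of i] R.admissible_near[OF x, of "i + 1"] True by linarith
    then have "L * \<bar>x (k (i + 1)) - x (k i)\<bar> \<le> L * (\<rho> i + \<rho> (i + 1))"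
      using W.L_pos by (intro mult_left_mono) auto
    then show ?thesis using W.action_ge[of "k i" "k (i + 1)" x] R.k_less[of i] True by (simp add: V_def)
  next
    case False
    have "x \<in> Y_space u0 u1 (v i) (k i) (\<rho> i) \<inter> Y_space u0 u1 (v (i + 1)) (k (i + 1)) (\<rho> (i + 1))"
      using x R.admissible_near[OF x] by (auto simp: Y_space_def R.admissible_def)
    from switch_cost_lower(1)[OF tw R.k_less R.v_in R.v_in R.\<rho>_pos R.\<rho>_pos this]
    have "0 \<le> action (\<lambda>a b. h a b - c) x (k i) (k (i + 1)) - V i" using False by (simp add: V_def)
    moreover have "0 \<le> L * (\<rho> i + \<rho> (i + 1))"
      using W.L_pos R.\<rho>_pos[of i] R.\<rho>_pos[of "i + 1"] by simp
    ultimately show ?thesis by linarith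
  qed
  have upper: "action (\<lambda>a b. h a b - c) T (k i) (k (i + 1)) - V i \<le> \<eta> i + L * (\<rho> i + \<rho> (i + 1))" for i
  proof (cases "v i = v (i + 1)")
    case True
    have "0 \<le> L * (\<rho> i + \<rho> (i + 1))"
      using W.L_pos R.\<rho>_pos[of i] R.\<rho>_pos[of "i + 1"] by simp
    then show ?thesis using R.T_rest[OF True, of "k i" "k (i + 1)"] R.k_less[of i] R.\<eta>(1)[of i] True
      by (simp add: V_def)
  next
    case False
    then show ?thesis
      using switch_cost_lower(2)[where i = i and k = k and \<rho> = \<rho>, OF tw R.k_less R.v_in R.v_in R.\<rho>_pos R.\<rho>_pos,
          of i "i + 1"] R.T_action[of i] by (simp add: V_def)
  qed
  note ren = R.renormalized_action[OF k0 \<rho>_half lower upper]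
  have conv: "convergent (J_partial h u0 u1 A0 A1 k \<rho> y)" if "y \<in> R.admissible" for y
    unfolding J by (rule ren(1)[OF _ that])
  have "k \<in> K_seqs" using k0 R.k_less by (simp add: K_seqs_def)
  moreover have "\<rho> \<in> P_seqs u0 u1 A0 A1"
    using summable_on_of_half_powers[OF _ \<rho>_half] R.\<rho>_pos R.\<rho>_less
    by (auto simp: P_seqs_def less_imp_le)
  moreover have "\<exists>x. J_minimizer h u0 u1 A0 A1 k \<rho> x"
  proof -
    obtain x where x: "x \<in> R.admissible" "\<forall>y\<in>R.admissible. J_functional h u0 u1 A0 A1 k \<rho> x
        \<le> J_functional h u0 u1 A0 A1 k \<rho> y"
      using ren(2) unfolding J_functional_def J by blast
    then have "J_functional h u0 u1 A0 A1 k \<rho> x = (INF y\<in>R.admissible. J_functional h u0 u1 A0 A1 k \<rho> y)"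
      by (intro antisym INF_greatest INF_lower) auto
    then show ?thesis using x(1) conv by (auto simp: J_minimizer_def F)
  qed
  moreover have "stationary h x \<and> has_transitions u0 u1 k \<rho> x (ecard (switches A0 A1))"
    if x: "J_minimizer h u0 u1 A0 A1 k \<rho> x" for x
  proof
    have xF: "x \<in> R.admissible" using x by (simp add: J_minimizer_def F)
    have "J_functional h u0 u1 A0 A1 k \<rho> x \<le> J_functional h u0 u1 A0 A1 k \<rho> y" if "y \<in> R.admissible" for y
      using x that by (simp add: J_minimizer_def F INF_lower)
    then have min: "R.local_minimizer x"
      by (intro ren(3)[OF _ xF]) (simp_all add: J_functional_def J)
    have "\<exists>\<delta>>0. \<forall>t. \<bar>t - x j\<bar> < \<delta> \<longrightarrow>
        h (x (j - 1)) (x j) + h (x j) (x (j + 1)) \<le> h (x (j - 1)) t + h t (x (j + 1))" for j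
    proof (rule R.one_site_minimal[OF min, of j])
      fix \<delta> assume "0 < \<delta>" and "\<And>t. \<bar>t - x j\<bar> < \<delta> \<Longrightarrow>
        h (x (j - 1)) (x j) - c + (h (x j) (x (j + 1)) - c) \<le> h (x (j - 1)) t - c + (h t (x (j + 1)) - c)"
      then show ?thesis by (intro exI[of _ \<delta>]) force
    qed
    then show "stationary h x" by (rule stationary_if_one_site_minimal)
    show "has_transitions u0 u1 k \<rho> x (ecard (switches A0 A1))"
      by (rule transitions_eq_switches[OF assms(3,4) W.u0_less_u1 R.\<rho>_less]) (simp add: F xF)
  qed
  ultimately show "\<exists>k \<in> K_seqs. \<exists>\<rho> \<in> P_seqs u0 u1 A0 A1. (\<forall>i. \<rho> i < \<epsilon>) \<and>
    (\<exists>x. J_minimizer h u0 u1 A0 A1 k \<rho> x) \<and>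
    (\<forall>x. J_minimizer h u0 u1 A0 A1 k \<rho> x \<longrightarrow>
       stationary h x \<and> has_transitions u0 u1 k \<rho> x (ecard (switches A0 A1)))"
    using \<rho>\<epsilon> by blast
qed

end
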